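(* Let $\mathcal{O}\in\{\mathrm{MIO},\mathrm{DIO},\mathrm{IO},\mathrm{SIO}\}$. For any density matrix $\rho$ on $\mathcal{H}_d$ with $d\in\{2,3\}$ (any qubit or qutrit state), the asymptotic zero-error assisted distillation rate is $$\lim_{n\to\infty}\frac1nC_{A,\mathcal{O}}^{(1),0}(\rho^{\otimes n})=-\log\|\Delta(\rho)\|_\infty.$$
   Context: $\mathcal{H}_d$ is a complex Hilbert space of finite dimension $d$ with a fixed orthonormal (reference) basis $\{|i\rangle\}_{i=1}^d$; the reference basis of $\mathcal{H}_d^{\otimes n}$ is the product basis. $\log$ is base 2. For a unit vector $|\psi\rangle$, $\psi:=|\psi\rangle\langle\psi|$. $\langle X,Y\rangle=\mathrm{Tr}(X^\dagger Y)$; $\|\cdot\|_\infty$ is the operator norm. $\Delta$ denotes the dephasing map $\Delta(X)=\sum_i|i\rangle\langle i|X|i\rangle\langle i|$ in the reference basis of the relevant space; a state $\omega$ is incoherent if $\omega=\Delta(\omega)$. Free operations (quantum channels from operators on a finite-dimensional space with reference basis to operators on an $m$-dimensional space with its own reference basis $\{|i\rangle\}_{i=1}^m$): MIO are channels mapping every incoherent state to an incoherent state; DIO are channels $\mathscr{E}$ with $\Delta[\mathscr{E}(X)]=\mathscr{E}[\Delta(X)]$ for all $X$; IO are channels having a Kraus decomposition $\{K_\ell\}$ with every $K_\ell$ incoherent, i.e. $K_\ell\sigma K_\ell^\dagger$ is diagonal for every incoherent $\sigma$; SIO are channels having a Kraus decomposition $\{K_\ell\}$ in which all $K_\ell$ and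 all $K_\ell^\dagger$ are incoherent in this sense. $|\Psi_m\rangle=\sum_{i=1}^m\frac1{\sqrt m}|i\rangle$. For a density matrix $\tau$ on a finite-dimensional space with reference basis, $$F_{A,\mathcal{O}}(\tau,m):=\max\Big\{\Big\langle\sum_ip_i\Lambda_i(\psi_i),\Psi_m\Big\rangle : \tau=\sum_ip_i\psi_i,\ \Lambda_i\in\mathcal{O}\ \forall i\Big\},$$ where the maximum is over all (finite) pure-state convex decompositions of $\tau$ and all choices of $\Lambda_i$. The zero-error one-shot assisted distillation rate is $$C_{A,\mathcal{O}}^{(1),0}(\tau):=\log\max\{m\in\mathbb{N}: F_{A,\mathcal{O}}(\tau,m)\ge1\}.$$ *)

theory Defs
  imports Complex_Main "Jordan_Normal_Form.Schur_Decomposition"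
begin

text \<open>
  Operators on an \<open>n\<close>-dimensional space are \<open>n \<times> n\<close> complex matrices with respect to its reference
  basis, which is indexed by \<open>0, \<dots>, n - 1\<close>. On complex numbers, \<open>0 \<le> z\<close> means that \<open>z\<close> is real and
  nonnegative.
\<close>

definition mat_trace :: "complex mat \<Rightarrow> complex" where
  "mat_trace A = (\<Sum>i<dim_row A. A $$ (i, i))"

definition hs_inner :: "complex mat \<Rightarrow> complex mat \<Rightarrow> complex" where
  "hs_inner X Y = mat_trace (mat_adjoint X * Y)"

definition vec_l2 :: "complex vec \<Rightarrow> real" where
  "vec_l2 v = sqrt (Re (v \<bullet>c v))"

definition unit_vecs :: "nat \<Rightarrow> complex vec set" where
  "unit_vecs n = {v \<in> carrier_vec n. vec_l2 v = 1}"

definition mat_op_norm :: "complex mat \<Rightarrow> real" where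
  "mat_op_norm A = (SUP v \<in> unit_vecs (dim_col A). vec_l2 (A *\<^sub>v v))"

text \<open>The rank-one operator \<open>|v><v|\<close>.\<close>

definition ketbra :: "complex vec \<Rightarrow> complex mat" where
  "ketbra v = mat (dim_vec v) (dim_vec v) (\<lambda>(i, j). v $ i * cnj (v $ j))"

text \<open>Matrices of all sizes share one type, so a sum of matrices needs its dimensions explicitly.\<close>

definition mat_sum :: "nat \<Rightarrow> nat \<Rightarrow> ('i \<Rightarrow> complex mat) \<Rightarrow> 'i set \<Rightarrow> complex mat" where
  "mat_sum r c f I = mat r c (\<lambda>(a, b). \<Sum>i\<in>I. f i $$ (a, b))"

text \<open>The product basis vector \<open>|i> \<otimes> |k>\<close> has index \<open>i * n + k\<close>, \<open>n\<close> being the dimension of the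
  second factor.\<close>

definition kron_mat :: "complex mat \<Rightarrow> complex mat \<Rightarrow> complex mat" where
  "kron_mat A B = mat (dim_row A * dim_row B) (dim_col A * dim_col B)
     (\<lambda>(i, j). A $$ (i div dim_row B, j div dim_col B) * B $$ (i mod dim_row B, j mod dim_col B))"

primrec tensor_pow :: "complex mat \<Rightarrow> nat \<Rightarrow> complex mat" where
  "tensor_pow A 0 = 1\<^sub>m 1"
| "tensor_pow A (Suc n) = kron_mat A (tensor_pow A n)"

definition psd_mat :: "nat \<Rightarrow> complex mat \<Rightarrow> bool" where
  "psd_mat n A \<longleftrightarrow> A \<in> carrier_mat n n \<and> (\<forall>v \<in> carrier_vec n. 0 \<le> (A *\<^sub>v v) \<bullet>c v)"

definition density_mat :: "nat \<Rightarrow> complex mat \<Rightarrow> bool" where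
  "density_mat n A \<longleftrightarrow> psd_mat n A \<and> mat_trace A = 1"

definition dephase :: "complex mat \<Rightarrow> complex mat" where
  "dephase X = mat (dim_row X) (dim_col X) (\<lambda>(i, j). if i = j then X $$ (i, j) else 0)"

definition incoherent_state :: "nat \<Rightarrow> complex mat \<Rightarrow> bool" where
  "incoherent_state n \<omega> \<longleftrightarrow> density_mat n \<omega> \<and> dephase \<omega> = \<omega>"

text \<open>
  \<open>ampliate k n m E\<close> is \<open>id \<otimes> E\<close>, where \<open>id\<close> is the identity map on \<open>k \<times> k\<close> matrices: \<open>E\<close> is applied
  to each of the \<open>n \<times> n\<close> blocks of its argument.
\<close>

definition ampliate ::
  "nat \<Rightarrow> nat \<Rightarrow> nat \<Rightarrow> (complex mat \<Rightarrow> complex mat) \<Rightarrow> complex mat \<Rightarrow> complex mat" where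
  "ampliate k n m E X = mat (k * m) (k * m)
     (\<lambda>(r, s). E (mat n n (\<lambda>(i, j). X $$ ((r div m) * n + i, (s div m) * n + j))) $$ (r mod m, s mod m))"

text \<open>Channels are completely positive trace-preserving linear maps; only their values on
  \<open>carrier_mat n n\<close> are constrained.\<close>

definition channel :: "nat \<Rightarrow> nat \<Rightarrow> (complex mat \<Rightarrow> complex mat) \<Rightarrow> bool" where
  "channel n m E \<longleftrightarrow>
     (\<forall>X \<in> carrier_mat n n. E X \<in> carrier_mat m m) \<and>
     (\<forall>X \<in> carrier_mat n n. \<forall>Y \<in> carrier_mat n n. E (X + Y) = E X + E Y) \<and>
     (\<forall>c. \<forall>X \<in> carrier_mat n n. E (c \<cdot>\<^sub>m X) = c \<cdot>\<^sub>m E X) \<and>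
     (\<forall>X \<in> carrier_mat n n. mat_trace (E X) = mat_trace X) \<and>
     (\<forall>k X. psd_mat (k * n) X \<longrightarrow> psd_mat (k * m) (ampliate k n m E X))"

definition kraus_decomp ::
  "nat \<Rightarrow> nat \<Rightarrow> (complex mat \<Rightarrow> complex mat) \<Rightarrow> complex mat list \<Rightarrow> bool" where
  "kraus_decomp n m E Ks \<longleftrightarrow> set Ks \<subseteq> carrier_mat m n \<and>
     (\<forall>X \<in> carrier_mat n n.
        E X = mat_sum m m (\<lambda>l. Ks ! l * X * mat_adjoint (Ks ! l)) {..<length Ks})"

definition incoherent_op :: "complex mat \<Rightarrow> bool" where
  "incoherent_op K \<longleftrightarrow>
     (\<forall>\<sigma>. incoherent_state (dim_col K) \<sigma> \<longrightarrow> diagonal_mat (K * \<sigma> * mat_adjoint K))"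

text \<open>The classes of free operations, as functions of the input and output dimensions.\<close>

type_synonym operation_class = "nat \<Rightarrow> nat \<Rightarrow> (complex mat \<Rightarrow> complex mat) set"

definition MIO :: operation_class where
  "MIO n m = {E. channel n m E \<and> (\<forall>\<omega>. incoherent_state n \<omega> \<longrightarrow> incoherent_state m (E \<omega>))}"

definition DIO :: operation_class where
  "DIO n m = {E. channel n m E \<and> (\<forall>X \<in> carrier_mat n n. dephase (E X) = E (dephase X))}"

definition IO :: operation_class where
  "IO n m = {E. channel n m E \<and>
     (\<exists>Ks. kraus_decomp n m E Ks \<and> (\<forall>K \<in> set Ks. incoherent_op K))}"

definition SIO :: operation_class where
  "SIO n m = {E. channel n m E \<and>
     (\<exists>Ks. kraus_decomp n m E Ks \<and>
        (\<forall>K \<in> set Ks. incoherent_op K \<and> incoherent_op (mat_adjoint K)))}"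

definition max_coherent_vec :: "nat \<Rightarrow> complex vec" where
  "max_coherent_vec m = vec m (\<lambda>i. complex_of_real (1 / sqrt (real m)))"

definition pure_decomp ::
  "complex mat \<Rightarrow> nat \<Rightarrow> (nat \<Rightarrow> real) \<Rightarrow> (nat \<Rightarrow> complex vec) \<Rightarrow> bool" where
  "pure_decomp \<tau> k p \<psi> \<longleftrightarrow>
     (\<forall>i<k. 0 \<le> p i) \<and> (\<Sum>i<k. p i) = 1 \<and> (\<forall>i<k. \<psi> i \<in> unit_vecs (dim_row \<tau>)) \<and>
     \<tau> = mat_sum (dim_row \<tau>) (dim_row \<tau>) (\<lambda>i. complex_of_real (p i) \<cdot>\<^sub>m ketbra (\<psi> i)) {..<k}"

text \<open>
  The maximum in the definition of the assisted fidelity is written as a supremum; the values are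
  bounded by 1. The inner product is real because both arguments are Hermitian, so taking its real
  part only changes the type.
\<close>

definition assisted_fidelity :: "operation_class \<Rightarrow> complex mat \<Rightarrow> nat \<Rightarrow> real" where
  "assisted_fidelity \<O> \<tau> m = Sup
     {Re (hs_inner (mat_sum m m (\<lambda>i. complex_of_real (p i) \<cdot>\<^sub>m \<Lambda> i (ketbra (\<psi> i))) {..<k})
            (ketbra (max_coherent_vec m))) | k p \<psi> \<Lambda>.
        pure_decomp \<tau> k p \<psi> \<and> (\<forall>i<k. \<Lambda> i \<in> \<O> (dim_row \<tau>) m)}"

definition zero_error_assisted_rate :: "operation_class \<Rightarrow> complex mat \<Rightarrow> real" where
  "zero_error_assisted_rate \<O> \<tau> =
     log 2 (real (Max {m::nat. 1 \<le> m \<and> 1 \<le> assisted_fidelity \<O> \<tau> m}))"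

end

theory Submission
  imports Defs
begin

text \<open>
  Up to dimension 3 the extreme correlation matrices (positive semidefinite matrices with unit diagonal)
  have rank one. Hence a qubit or qutrit state \<open>\<rho>\<close> is a mixture of pure states with the diagonal
  of \<open>\<rho>\<close>, and tensor powers inherit this property. A pure state can be mapped to the maximally coherent
  state of dimension \<open>m\<close> by operations in SIO and DIO as soon as its diagonal is bounded by
  \<open>1 / m\<close>, because such a probability vector is a mixture of uniform distributions on \<open>m\<close>-element sets.
  Conversely, for \<open>\<Lambda>\<close> in MIO the effect \<open>W\<close> dual to the maximally coherent state satisfies
  \<open>0 \<le> W \<le> 1\<close> and has all diagonal entries \<open>1 / m\<close>, so \<open>\<langle>\<psi>, W \<psi>\<rangle>\<close> close to 1 forces \<open>|\<psi>\<^sub>j|\<^sup>2\<close> to be at most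
  about \<open>1 / m\<close>. The largest \<open>m\<close> for the \<open>n\<close>-th tensor power is therefore the integer part
  of the \<open>n\<close>-th power of the inverse of the largest diagonal entry.
\<close>

section \<open>Matrices and channels\<close>

text \<open>An \<open>n \<times> n\<close> correlation matrix of rank \<open>r\<close> is the Gram
  matrix of \<open>n\<close> unit vectors in \<open>C^r\<close>, and it is extreme exactly if their
  rank-one projectors span the \<open>r^2\<close>-dimensional real space of Hermitian matrices.
  Hence \<open>r^2 \<le> n\<close>, which forces \<open>r = 1\<close> up to dimension 3, while rank
  2 occurs from dimension 4 on. The proof replaces this convexity argument by an explicit mixture of
  four vectors. The fidelity is a supremum over decompositions of any length, so the value 1 yields
  only protocols that are almost perfect. The converse therefore needs an estimate that tolerates a
  small defect and is affine in the overlap, so that it survives averaging over the decomposition.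
  What makes the average informative is that the squared moduli of the \<open>j\<close>-th
  amplitudes average to the \<open>j\<close>-th diagonal entry of the state, whatever the
  decomposition.\<close>

lemma sum_lessThan_mult:
  fixes f :: "nat \<Rightarrow> 'a::comm_monoid_add"
  shows "(\<Sum>i<k * m. f i) = (\<Sum>p<k. \<Sum>a<m. f (p * m + a))"
proof -
  have "sum f {p * m..<p * m + m} = (\<Sum>a<m. f (p * m + a))" for p
    using sum.shift_bounds_nat_ivl[of f 0 "p * m" m]
    by (simp add: add.commute lessThan_atLeast0)
  then show ?thesis
    by (subst sum.nat_group[symmetric]) simp
qed

lemma mult_add_less:
  fixes p a k m :: nat
  assumes "p < k" "a < m"
  shows "p * m + a < k * m"
proof -
  have "p * m + a < Suc p * m" using assms by simp
  also have "\<dots> \<le> k * m" using assms by (intro mult_right_mono) auto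
  finally show ?thesis .
qed

lemma mat_adjoint_carrier [simp]:
  "K \<in> carrier_mat m n \<Longrightarrow> mat_adjoint K \<in> carrier_mat n m"
  by (auto simp: mat_adjoint_def)

lemma mat_adjoint_entry:
  fixes K :: "complex mat"
  shows "K \<in> carrier_mat m n \<Longrightarrow> i < n \<Longrightarrow> a < m \<Longrightarrow> mat_adjoint K $$ (i, a) = cnj (K $$ (a, i))"
  by (auto simp: mat_adjoint_def mat_of_rows_def)

lemma conjugation_entry:
  fixes K X :: "complex mat"
  assumes "K \<in> carrier_mat m n" "X \<in> carrier_mat n n" "a < m" "b < m"
  shows "(K * X * mat_adjoint K) $$ (a, b)
           = (\<Sum>i<n. \<Sum>j<n. K $$ (a, i) * X $$ (i, j) * cnj (K $$ (b, j)))"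
proof -
  have "(K * X * mat_adjoint K) $$ (a, b)
      = (\<Sum>j<n. (\<Sum>i<n. K $$ (a, i) * X $$ (i, j)) * mat_adjoint K $$ (j, b))"
    using assms carrier_matD[OF mat_adjoint_carrier[OF assms(1)]]
    by (simp add: scalar_prod_def lessThan_atLeast0)
  also have "\<dots> = (\<Sum>j<n. \<Sum>i<n. K $$ (a, i) * X $$ (i, j) * cnj (K $$ (b, j)))"
    using assms by (simp add: mat_adjoint_entry sum_distrib_right)
  finally show ?thesis by (subst sum.swap)
qed

lemma quadratic_form:
  fixes A :: "complex mat"
  assumes "A \<in> carrier_mat n n" "v \<in> carrier_vec n"
  shows "(A *\<^sub>v v) \<bullet>c v = (\<Sum>a<n. \<Sum>b<n. A $$ (a, b) * v $ b * cnj (v $ a))"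
  using assms
  by (simp add: scalar_prod_def lessThan_atLeast0 sum_distrib_right)

lemma mat_trace_eq: "A \<in> carrier_mat n n \<Longrightarrow> mat_trace A = (\<Sum>i<n. A $$ (i, i))"
  by (simp add: mat_trace_def)

lemma psd_mat_ketbra: "v \<in> carrier_vec n \<Longrightarrow> psd_mat n (ketbra v)"
  unfolding psd_mat_def
proof (intro conjI ballI)
  fix w :: "complex vec" assume v: "v \<in> carrier_vec n" and w: "w \<in> carrier_vec n"
  have "(ketbra v *\<^sub>v w) \<bullet>c w = (\<Sum>a<n. \<Sum>b<n. v $ a * cnj (v $ b) * w $ b * cnj (w $ a))"
    using v w by (subst quadratic_form) (auto simp: ketbra_def)
  also have "\<dots> = (\<Sum>a<n. v $ a * cnj (w $ a)) * cnj (\<Sum>a<n. v $ a * cnj (w $ a))"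
    by (simp add: sum_product mult_ac)
  also have "\<dots> = complex_of_real ((cmod (\<Sum>a<n. v $ a * cnj (w $ a)))\<^sup>2)"
    by (simp only: complex_norm_square)
  finally show "0 \<le> (ketbra v *\<^sub>v w) \<bullet>c w"
    by (simp add: less_eq_complex_def flip: of_real_power)
qed (auto simp: ketbra_def)

lemma ketbra_carrier [simp]: "v \<in> carrier_vec n \<Longrightarrow> ketbra v \<in> carrier_mat n n"
  by (auto simp: ketbra_def)

lemma ketbra_entry: "v \<in> carrier_vec n \<Longrightarrow> i < n \<Longrightarrow> j < n \<Longrightarrow> ketbra v $$ (i, j) = v $ i * cnj (v $ j)"
  by (auto simp: ketbra_def)

lemma Re_self_cscalar_prod: "v \<in> carrier_vec n \<Longrightarrow> Re (v \<bullet>c v) = (\<Sum>i<n. (cmod (v $ i))\<^sup>2)"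
  by (simp add: scalar_prod_def lessThan_atLeast0 cmod_power2 flip: power2_eq_square)

lemma unit_vecs_iff: "v \<in> unit_vecs n \<longleftrightarrow> v \<in> carrier_vec n \<and> (\<Sum>i<n. (cmod (v $ i))\<^sup>2) = 1"
  by (auto simp: unit_vecs_def vec_l2_def Re_self_cscalar_prod)

lemma mat_trace_ketbra:
  "v \<in> carrier_vec n \<Longrightarrow> mat_trace (ketbra v) = complex_of_real (\<Sum>i<n. (cmod (v $ i))\<^sup>2)"
  by (simp add: mat_trace_eq[OF ketbra_carrier] ketbra_entry flip: complex_norm_square)

text \<open>Complete positivity with a one-dimensional ancilla: for \<open>k = 1\<close> the only
  block of \<open>X\<close> is \<open>X\<close> itself.\<close>

lemma channel_psd:
  assumes "channel n m E" "psd_mat n X"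
  shows "psd_mat m (E X)"
proof -
  have X: "X \<in> carrier_mat n n" using assms(2) by (simp add: psd_mat_def)
  have EX: "E X \<in> carrier_mat m m" using assms X by (simp add: channel_def)
  have block: "mat n n (($$) X) = X"
    using X by auto
  have "ampliate 1 n m E X = E X"
    using EX by (intro eq_matI) (auto simp: ampliate_def block)
  moreover have "\<forall>k X. psd_mat (k * n) X \<longrightarrow> psd_mat (k * m) (ampliate k n m E X)"
    using assms(1) by (simp add: channel_def)
  from this[rule_format, of 1 X] have "psd_mat (1 * m) (ampliate 1 n m E X)"
    using assms(2) by simp
  ultimately show ?thesis by simp
qed

lemma channel_density: "channel n m E \<Longrightarrow> density_mat n X \<Longrightarrow> density_mat m (E X)"
  using channel_psd[of n m E X] by (auto simp: density_mat_def channel_def psd_mat_def)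

lemma dephase_diagonal: "A \<in> carrier_mat n n \<Longrightarrow> diagonal_mat A \<Longrightarrow> dephase A = A"
  by (rule eq_matI) (auto simp: dephase_def diagonal_mat_def)

text \<open>A map that commutes with dephasing sends fixed points of \<open>dephase\<close> to fixed
  points.\<close>

lemma DIO_subset_MIO: "DIO n m \<subseteq> MIO n m"
proof
  fix E assume E: "E \<in> DIO n m"
  then have "incoherent_state m (E \<omega>)" if "incoherent_state n \<omega>" for \<omega>
    using that channel_density[of n m E \<omega>]
    by (auto simp: DIO_def incoherent_state_def density_mat_def psd_mat_def)
  with E show "E \<in> MIO n m" by (simp add: DIO_def MIO_def)
qed

lemma IO_subset_MIO: "IO n m \<subseteq> MIO n m"
proof
  fix E assume "E \<in> IO n m"
  then obtain Ks where E: "channel n m E" and Ks: "kraus_decomp n m E Ks"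
    and inc: "\<forall>K \<in> set Ks. incoherent_op K"
    by (auto simp: IO_def)
  have "incoherent_state m (E \<omega>)" if \<omega>: "incoherent_state n \<omega>" for \<omega>
  proof -
    have c: "\<omega> \<in> carrier_mat n n"
      using \<omega> by (simp add: incoherent_state_def density_mat_def psd_mat_def)
    have "E \<omega> = mat_sum m m (\<lambda>l. Ks ! l * \<omega> * mat_adjoint (Ks ! l)) {..<length Ks}"
      using Ks c by (simp add: kraus_decomp_def)
    moreover have "(Ks ! l * \<omega> * mat_adjoint (Ks ! l)) $$ (a, b) = 0"
      if "l < length Ks" "a < m" "b < m" "a \<noteq> b" for l a b
    proof -
      have K: "Ks ! l \<in> carrier_mat m n" "incoherent_op (Ks ! l)"
        using Ks inc that(1) by (auto simp: kraus_decomp_def)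
      then have "diagonal_mat (Ks ! l * \<omega> * mat_adjoint (Ks ! l))"
        using \<omega> by (auto simp: incoherent_op_def)
      then show ?thesis
        using carrier_matD[OF K(1)] carrier_matD[OF mat_adjoint_carrier[OF K(1)]] that
        by (simp add: diagonal_mat_def del: index_mult_mat(1))
    qed
    ultimately have "diagonal_mat (E \<omega>)"
      by (auto simp: diagonal_mat_def mat_sum_def)
    then show ?thesis
      using E c \<omega> channel_density[OF E] dephase_diagonal[of "E \<omega>" m]
      by (simp add: incoherent_state_def channel_def)
  qed
  then show "E \<in> MIO n m" using E by (simp add: MIO_def)
qed

lemma SIO_subset_IO: "SIO n m \<subseteq> IO n m"
  by (auto simp: SIO_def IO_def)

section \<open>Kraus operators that partially permute the reference basis\<close>

definition kraus_map :: "nat \<Rightarrow> complex mat list \<Rightarrow> complex mat \<Rightarrow> complex mat" where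
  "kraus_map m Ks X = mat_sum m m (\<lambda>l. Ks ! l * X * mat_adjoint (Ks ! l)) {..<length Ks}"

lemma kraus_map_entry:
  assumes "set Ks \<subseteq> carrier_mat m n" "X \<in> carrier_mat n n" "a < m" "b < m"
  shows "kraus_map m Ks X $$ (a, b)
    = (\<Sum>l<length Ks. \<Sum>i<n. \<Sum>j<n. (Ks ! l) $$ (a, i) * X $$ (i, j) * cnj ((Ks ! l) $$ (b, j)))"
proof -
  have "Ks ! l \<in> carrier_mat m n" if "l < length Ks" for l
    using assms(1) that nth_mem by blast
  then show ?thesis
    using assms by (simp add: kraus_map_def mat_sum_def conjugation_entry[where m = m and n = n])
qed

lemma kraus_map_carrier [simp]: "kraus_map m Ks X \<in> carrier_mat m m"
  by (simp add: kraus_map_def mat_sum_def)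

text \<open>The quadratic form of the image at \<open>v\<close> is the sum over \<open>l\<close> of
  the form of \<open>X\<close> at \<open>W l\<close>, which is the adjoint of the
  \<open>l\<close>-th Kraus operator applied to each block of \<open>v\<close>. Positivity is
  inherited term by term; the rest reorders sums over blocks and entries.\<close>

lemma kraus_map_completely_positive:
  assumes Ks: "set Ks \<subseteq> carrier_mat m n" and X: "psd_mat (k * n) X"
  shows "psd_mat (k * m) (ampliate k n m (kraus_map m Ks) X)"
  unfolding psd_mat_def
proof (intro conjI ballI)
  show amp_carrier: "ampliate k n m (kraus_map m Ks) X \<in> carrier_mat (k * m) (k * m)"
    by (simp add: ampliate_def)
  fix v :: "complex vec" assume v: "v \<in> carrier_vec (k * m)"
  have Xc: "X \<in> carrier_mat (k * n) (k * n)" using X by (simp add: psd_mat_def)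
  define K where "K l a i = (Ks ! l) $$ (a, i)" for l a i
  define L where "L = length Ks"
  define w where "w l q j = (\<Sum>b<m. cnj (K l b j) * v $ (q * m + b))" for l q j
  define W where "W l = vec (k * n) (\<lambda>r. w l (r div n) (r mod n))" for l
  have amp: "ampliate k n m (kraus_map m Ks) X $$ (p * m + a, q * m + b)
      = (\<Sum>l<L. \<Sum>i<n. \<Sum>j<n. K l a i * X $$ (p * n + i, q * n + j) * cnj (K l b j))"
    if "p < k" "a < m" "q < k" "b < m" for p a q b
    using that Ks by (simp add: ampliate_def mult_add_less kraus_map_entry K_def L_def)
  have block: "(\<Sum>a<m. \<Sum>b<m. (\<Sum>l<L. \<Sum>i<n. \<Sum>j<n. K l a i * x i j * cnj (K l b j))
        * v $ (q * m + b) * cnj (v $ (p * m + a)))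
      = (\<Sum>l<L. \<Sum>i<n. \<Sum>j<n. x i j * w l q j * cnj (w l p i))" for p q x
  proof -
    have "(\<Sum>l<L. \<Sum>i<n. \<Sum>j<n. x i j * w l q j * cnj (w l p i))
      = (\<Sum>l<L. \<Sum>i<n. \<Sum>j<n. \<Sum>a<m. \<Sum>b<m. K l a i * x i j * cnj (K l b j)
           * v $ (q * m + b) * cnj (v $ (p * m + a)))"
      unfolding w_def
      by (intro sum.cong refl)
        (subst sum.swap, simp add: sum_distrib_left sum_distrib_right mult_ac)
    also have "\<dots> = (\<Sum>a<m. \<Sum>l<L. \<Sum>i<n. \<Sum>j<n. \<Sum>b<m. K l a i * x i j * cnj (K l b j)
           * v $ (q * m + b) * cnj (v $ (p * m + a)))"
      by (simp only: sum.swap[of _ "{..<m}" "{..<n}"] sum.swap[of _ "{..<m}" "{..<L}"])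
    also have "\<dots> = (\<Sum>a<m. \<Sum>b<m. \<Sum>l<L. \<Sum>i<n. \<Sum>j<n. K l a i * x i j * cnj (K l b j)
           * v $ (q * m + b) * cnj (v $ (p * m + a)))"
      by (simp only: sum.swap[of _ "{..<m}" "{..<n}"] sum.swap[of _ "{..<m}" "{..<L}"])
    finally show ?thesis
      by (simp add: sum_distrib_right)
  qed
  have "(ampliate k n m (kraus_map m Ks) X *\<^sub>v v) \<bullet>c v
    = (\<Sum>p<k. \<Sum>a<m. \<Sum>q<k. \<Sum>b<m. ampliate k n m (kraus_map m Ks) X $$ (p * m + a, q * m + b)
        * v $ (q * m + b) * cnj (v $ (p * m + a)))"
    by (simp only: quadratic_form[OF amp_carrier v] sum_lessThan_mult)
  also have "\<dots> = (\<Sum>p<k. \<Sum>q<k. \<Sum>a<m. \<Sum>b<m. ampliate k n m (kraus_map m Ks) X $$ (p * m + a, q * m + b)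
        * v $ (q * m + b) * cnj (v $ (p * m + a)))"
    by (intro sum.cong refl sum.swap)
  also have "\<dots> = (\<Sum>p<k. \<Sum>q<k. \<Sum>l<L. \<Sum>i<n. \<Sum>j<n. X $$ (p * n + i, q * n + j) * w l q j * cnj (w l p i))"
    by (simp add: amp block)
  also have "\<dots> = (\<Sum>l<L. \<Sum>p<k. \<Sum>i<n. \<Sum>q<k. \<Sum>j<n. X $$ (p * n + i, q * n + j) * w l q j * cnj (w l p i))"
    by (simp only: sum.swap[of _ "{..<k}" "{..<n}"] sum.swap[of _ "{..<k}" "{..<L}"])
  also have "\<dots> = (\<Sum>l<L. (X *\<^sub>v W l) \<bullet>c W l)"
    by (intro sum.cong refl, subst quadratic_form[OF Xc])
      (auto simp: W_def sum_lessThan_mult mult_add_less)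
  also have "0 \<le> \<dots>"
    using X by (intro sum_nonneg) (simp add: psd_mat_def W_def)
  finally show "0 \<le> (ampliate k n m (kraus_map m Ks) X *\<^sub>v v) \<bullet>c v" .
qed

text \<open>At most one nonzero entry in each row and in each column. Writing this as an equivalence
  treats rows and columns alike, so the condition passes to the adjoint.\<close>

definition partial_injection :: "complex mat \<Rightarrow> bool" where
  "partial_injection K \<longleftrightarrow>
     (\<forall>a<dim_row K. \<forall>b<dim_row K. \<forall>i<dim_col K. \<forall>j<dim_col K.
        K $$ (a, i) \<noteq> 0 \<longrightarrow> K $$ (b, j) \<noteq> 0 \<longrightarrow> (a = b \<longleftrightarrow> i = j))"

text \<open>With a diagonal \<sigma>, an off-diagonal entry of the result needs two nonzero entries
  of \<open>K\<close> in the same column.\<close>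

lemma partial_injection_incoherent:
  assumes "partial_injection K"
  shows "incoherent_op K"
  unfolding incoherent_op_def
proof (intro allI impI)
  fix \<sigma> assume \<sigma>: "incoherent_state (dim_col K) \<sigma>"
  define m n where "m = dim_row K" and "n = dim_col K"
  have K: "K \<in> carrier_mat m n" by (simp add: m_def n_def)
  have s: "\<sigma> \<in> carrier_mat n n" and deph: "dephase \<sigma> = \<sigma>"
    using \<sigma> by (auto simp: incoherent_state_def density_mat_def psd_mat_def n_def)
  have off: "\<sigma> $$ (i, j) = 0" if "i < n" "j < n" "i \<noteq> j" for i j
    by (subst deph[symmetric]) (use that s in \<open>simp add: dephase_def\<close>)
  have "(K * \<sigma> * mat_adjoint K) $$ (a, b) = 0" if "a < m" "b < m" "a \<noteq> b" for a b
    unfolding conjugation_entry[OF K s that(1,2)]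
  proof (intro sum.neutral ballI)
    fix i j assume "i \<in> {..<n}" "j \<in> {..<n}"
    then show "K $$ (a, i) * \<sigma> $$ (i, j) * cnj (K $$ (b, j)) = 0"
      using assms off[of i j] that unfolding partial_injection_def m_def n_def
      by (cases "i = j") auto
  qed
  then show "diagonal_mat (K * \<sigma> * mat_adjoint K)"
    using carrier_matD[OF K] carrier_matD[OF mat_adjoint_carrier[OF K]]
    by (simp add: diagonal_mat_def del: index_mult_mat(1))
qed

lemma partial_injection_adjoint:
  assumes "partial_injection K"
  shows "partial_injection (mat_adjoint K)"
proof -
  have K: "K \<in> carrier_mat (dim_row K) (dim_col K)" by simp
  show ?thesis
    using assms carrier_matD[OF mat_adjoint_carrier[OF K]]
    by (auto simp: partial_injection_def mat_adjoint_entry[OF K])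
qed

context
  fixes n m :: nat and Ks :: "complex mat list"
  assumes Ks: "set Ks \<subseteq> carrier_mat m n"
    and inj: "\<And>K. K \<in> set Ks \<Longrightarrow> partial_injection K"
    and complete: "\<And>i. i < n \<Longrightarrow> (\<Sum>l<length Ks. \<Sum>a<m. (cmod ((Ks ! l) $$ (a, i)))\<^sup>2) = 1"
begin

lemma nth_carrier: "l < length Ks \<Longrightarrow> Ks ! l \<in> carrier_mat m n"
  using Ks nth_mem by blast

lemma nth_partial_injection:
  assumes "l < length Ks" "a < m" "b < m" "i < n" "j < n"
    and "(Ks ! l) $$ (a, i) \<noteq> 0" "(Ks ! l) $$ (b, j) \<noteq> 0"
  shows "a = b \<longleftrightarrow> i = j"
  using inj[of "Ks ! l"] nth_carrier[of l] assms unfolding partial_injection_def by auto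

text \<open>The terms with \<open>i \<noteq> j\<close> vanish because a row contains at most one
  nonzero entry. Trace preservation therefore reduces to the normalization of columns in
  \<open>complete\<close>.\<close>

lemma trace_kraus_map:
  assumes X: "X \<in> carrier_mat n n"
  shows "mat_trace (kraus_map m Ks X) = mat_trace X"
proof -
  have "mat_trace (kraus_map m Ks X)
      = (\<Sum>a<m. \<Sum>l<length Ks. \<Sum>i<n. \<Sum>j<n. (Ks ! l) $$ (a, i) * X $$ (i, j) * cnj ((Ks ! l) $$ (a, j)))"
    by (simp add: mat_trace_eq[OF kraus_map_carrier] kraus_map_entry[OF Ks X])
  also have "\<dots> = (\<Sum>a<m. \<Sum>l<length Ks. \<Sum>i<n. X $$ (i, i) * complex_of_real ((cmod ((Ks ! l) $$ (a, i)))\<^sup>2))"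
  proof (intro sum.cong refl)
    fix a l i assume *: "a \<in> {..<m}" "l \<in> {..<length Ks}" "i \<in> {..<n}"
    have "(\<Sum>j<n. (Ks ! l) $$ (a, i) * X $$ (i, j) * cnj ((Ks ! l) $$ (a, j)))
        = (\<Sum>j<n. if j = i then (Ks ! l) $$ (a, i) * X $$ (i, i) * cnj ((Ks ! l) $$ (a, i)) else 0)"
      using * nth_partial_injection[of l a a i] by (intro sum.cong refl) auto
    also have "\<dots> = X $$ (i, i) * complex_of_real ((cmod ((Ks ! l) $$ (a, i)))\<^sup>2)"
      unfolding complex_norm_square using * by (simp add: mult_ac)
    finally show "(\<Sum>j<n. (Ks ! l) $$ (a, i) * X $$ (i, j) * cnj ((Ks ! l) $$ (a, j)))
        = X $$ (i, i) * complex_of_real ((cmod ((Ks ! l) $$ (a, i)))\<^sup>2)" .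
  qed
  also have "\<dots> = (\<Sum>i<n. \<Sum>l<length Ks. \<Sum>a<m. X $$ (i, i) * complex_of_real ((cmod ((Ks ! l) $$ (a, i)))\<^sup>2))"
    by (simp only: sum.swap[of _ "{..<m}"] sum.swap[of _ "{..<n}" "{..<length Ks}"])
  also have "\<dots> = (\<Sum>i<n. X $$ (i, i) * complex_of_real (\<Sum>l<length Ks. \<Sum>a<m. (cmod ((Ks ! l) $$ (a, i)))\<^sup>2))"
    by (simp add: sum_distrib_left)
  also have "\<dots> = mat_trace X"
    using complete by (simp add: mat_trace_eq[OF X])
  finally show ?thesis .
qed

lemma channel_kraus_map: "channel n m (kraus_map m Ks)"
  unfolding channel_def
proof (intro conjI ballI allI impI)
  fix X Y :: "complex mat" assume XY: "X \<in> carrier_mat n n" "Y \<in> carrier_mat n n"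
  show "kraus_map m Ks (X + Y) = kraus_map m Ks X + kraus_map m Ks Y"
  proof (rule eq_matI)
    fix a b assume "a < dim_row (kraus_map m Ks X + kraus_map m Ks Y)"
      "b < dim_col (kraus_map m Ks X + kraus_map m Ks Y)"
    then have ab: "a < m" "b < m" using carrier_matD[OF kraus_map_carrier] by auto
    then show "kraus_map m Ks (X + Y) $$ (a, b) = (kraus_map m Ks X + kraus_map m Ks Y) $$ (a, b)"
      using XY carrier_matD[OF kraus_map_carrier]
      by (simp add: kraus_map_entry[OF Ks] algebra_simps sum.distrib)
  qed (use carrier_matD[OF kraus_map_carrier] in auto)
next
  fix c and X :: "complex mat" assume X: "X \<in> carrier_mat n n"
  show "kraus_map m Ks (c \<cdot>\<^sub>m X) = c \<cdot>\<^sub>m kraus_map m Ks X"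
  proof (rule eq_matI)
    fix a b assume "a < dim_row (c \<cdot>\<^sub>m kraus_map m Ks X)" "b < dim_col (c \<cdot>\<^sub>m kraus_map m Ks X)"
    then have ab: "a < m" "b < m" using carrier_matD[OF kraus_map_carrier] by auto
    then show "kraus_map m Ks (c \<cdot>\<^sub>m X) $$ (a, b) = (c \<cdot>\<^sub>m kraus_map m Ks X) $$ (a, b)"
      using X carrier_matD[OF kraus_map_carrier]
      by (simp add: kraus_map_entry[OF Ks] sum_distrib_left mult_ac)
  qed (use carrier_matD[OF kraus_map_carrier] in auto)
qed (simp_all add: trace_kraus_map kraus_map_completely_positive[OF Ks])

lemma kraus_map_SIO: "kraus_map m Ks \<in> SIO n m"
  using channel_kraus_map Ks inj partial_injection_incoherent partial_injection_adjoint
  unfolding SIO_def kraus_decomp_def kraus_map_def[abs_def] by blast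

text \<open>In every nonzero term of the Kraus sum, \<open>a = b\<close> holds exactly if
  \<open>i = j\<close>. Dephasing before or after the map thus removes the same terms.\<close>

lemma kraus_map_DIO: "kraus_map m Ks \<in> DIO n m"
proof -
  have "dephase (kraus_map m Ks X) = kraus_map m Ks (dephase X)" if X: "X \<in> carrier_mat n n" for X
  proof (rule eq_matI)
    fix a b assume "a < dim_row (kraus_map m Ks (dephase X))" "b < dim_col (kraus_map m Ks (dephase X))"
    then have ab: "a < m" "b < m" using carrier_matD[OF kraus_map_carrier] by auto
    have dX: "dephase X \<in> carrier_mat n n" using X by (simp add: dephase_def)
    have "kraus_map m Ks (dephase X) $$ (a, b)
        = (if a = b then kraus_map m Ks X $$ (a, b) else 0)"
    proof -
      have "(Ks ! l) $$ (a, i) * dephase X $$ (i, j) * cnj ((Ks ! l) $$ (b, j))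
          = (if a = b then (Ks ! l) $$ (a, i) * X $$ (i, j) * cnj ((Ks ! l) $$ (b, j)) else 0)"
        if "l < length Ks" "i < n" "j < n" for l i j
        using X that nth_partial_injection[OF that(1) ab that(2,3)]
        by (cases "i = j"; cases "a = b") (auto simp: dephase_def)
      then show ?thesis
        using ab by (simp add: kraus_map_entry[OF Ks] X dX)
    qed
    then show "dephase (kraus_map m Ks X) $$ (a, b) = kraus_map m Ks (dephase X) $$ (a, b)"
      using ab carrier_matD[OF kraus_map_carrier] by (simp add: dephase_def)
  qed (use carrier_matD[OF kraus_map_carrier] in \<open>auto simp: dephase_def\<close>)
  then show ?thesis using channel_kraus_map by (simp add: DIO_def)
qed

lemma kraus_map_free:
  assumes "\<O> \<in> {MIO, DIO, IO, SIO}"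
  shows "kraus_map m Ks \<in> \<O> n m"
  using assms kraus_map_SIO kraus_map_DIO SIO_subset_IO DIO_subset_MIO by blast

end

section \<open>Distillation of pure states\<close>

text \<open>Subtract the indicator of a set \<open>S\<close> containing all indices at the cap and contained in the support, with the
  largest weight that preserves the constraints: each round creates a new zero or a new index at
  the cap.\<close>

lemma capped_simplex_decomposition:
  fixes q :: "nat \<Rightarrow> real" and m N :: nat
  assumes "1 \<le> m" and "\<And>j. j < N \<Longrightarrow> 0 \<le> q j \<and> real m * q j \<le> s" and "(\<Sum>j<N. q j) = s"
  shows "\<exists>L r S. (\<forall>l<L::nat. 0 < r l \<and> S l \<subseteq> {..<N} \<and> card (S l) = m) \<and>
           (\<forall>j<N. q j = (\<Sum>l<L. if j \<in> S l then r l else 0))"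
  using assms(2,3)
proof (induction "card {j. j < N \<and> 0 < q j \<and> real m * q j < s}" arbitrary: q s rule: less_induct)
  case less
  note q = less.prems
  show ?case
  proof (cases "s = 0")
    case True
    then have "\<forall>j<N. q j = 0" using q sum_nonneg_eq_0_iff[of "{..<N}" q] by auto
    then show ?thesis by (intro exI[of _ 0]) simp
  next
    case False
    have "0 \<le> s" using q by (metis lessThan_iff sum_nonneg)
    with False have s: "0 < s" by simp
    define T where "T = {j. j < N \<and> real m * q j = s}"
    define P where "P = {j. j < N \<and> 0 < q j}"
    have fin: "finite T" "finite P" by (auto simp: T_def P_def)
    have TP: "T \<subseteq> P" using s assms(1) by (auto simp: T_def P_def zero_less_mult_iff)
    \<comment> \<open>The numbers \<open>m * q j\<close> sum to \<open>m * s\<close>. Each index at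
      the cap contributes \<open>s\<close>, so there are at most \<open>m\<close> of them; each
      index in the support contributes at most \<open>s\<close>, so there are at least
      \<open>m\<close> of those.\<close>
    have "(\<Sum>j\<in>T. real m * q j) \<le> (\<Sum>j<N. real m * q j)"
      using q by (intro sum_mono2) (auto simp: T_def)
    also have "\<dots> = real m * s" using q(2) by (simp flip: sum_distrib_left)
    finally have "real (card T) * s \<le> real m * s" by (simp add: T_def)
    then have cT: "card T \<le> m" using s by simp
    have "real m * s = (\<Sum>j\<in>P. real m * q j)"
      unfolding q(2)[symmetric] sum_distrib_left
      using q(1) by (intro sum.mono_neutral_right) (force simp: P_def)+
    also have "\<dots> \<le> (\<Sum>j\<in>P. s)" using q by (intro sum_mono) (auto simp: P_def)
    finally have cP: "m \<le> card P" using s by simp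
    obtain S where S: "T \<subseteq> S" "S \<subseteq> P" "card S = m"
      using exists_subset_between[OF cT cP TP fin(2)] by blast
    have finS: "finite S" using S fin finite_subset by blast
    have SN: "S \<subseteq> {..<N}" using S by (auto simp: P_def)
    have Sne: "S \<noteq> {}" using S assms(1) by auto
    \<comment> \<open>Subtracting \<open>r\<close> on \<open>S\<close> lowers the total by
      \<open>m * r\<close>, and the cap moves with it. Indices in \<open>S\<close> limit
      \<open>r\<close> only by nonnegativity, the others by their slack below the cap.\<close>
    define V where "V = q ` S \<union> (\<lambda>j. (s - real m * q j) / real m) ` ({..<N} - S)"
    define r where "r = Min V"
    have V: "finite V" "V \<noteq> {}" using finS Sne by (auto simp: V_def)
    have "0 < v" if "v \<in> V" for v
      using that q(1) S assms(1) unfolding V_def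
      by (force simp: P_def T_def less_le)
    then have r: "0 < r" using V Min_in unfolding r_def by blast
    have r1: "r \<le> q j" if "j \<in> S" for j
      unfolding r_def using V that by (intro Min_le) (auto simp: V_def)
    have r2: "real m * q j \<le> s - real m * r" if "j < N" "j \<notin> S" for j
    proof -
      have "r \<le> (s - real m * q j) / real m"
        unfolding r_def using V that by (intro Min_le) (auto simp: V_def)
      then show ?thesis using assms(1) by (simp add: field_simps)
    qed
    define q' where "q' j = q j - (if j \<in> S then r else 0)" for j
    define s' where "s' = s - real m * r"
    have q'1: "0 \<le> q' j \<and> real m * q' j \<le> s'" if "j < N" for j
      using r1 r2 q(1) that by (auto simp: q'_def s'_def algebra_simps)
    have "(\<Sum>j<N. if j \<in> S then r else 0) = real m * r"
      using SN S(3) by (simp add: sum.If_cases Int_absorb1)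
    then have q'2: "(\<Sum>j<N. q' j) = s'"
      using q(2) by (simp add: q'_def s'_def sum_subtractf)
    have "\<exists>L r S. (\<forall>l<L::nat. 0 < r l \<and> S l \<subseteq> {..<N} \<and> card (S l) = m) \<and>
           (\<forall>j<N. q' j = (\<Sum>l<L. if j \<in> S l then r l else 0))"
    \<comment> \<open>If the remaining total is 0, the measure need not drop, since all of
      \<open>S\<close> may have been at the cap; but then nothing is left to decompose.\<close>
    proof (cases "s' = 0")
      case True
      then have "\<forall>j<N. q' j = 0" using q'1 q'2 sum_nonneg_eq_0_iff[of "{..<N}" q'] by auto
      then show ?thesis by (intro exI[of _ 0]) simp
    next
      case False
      have "0 \<le> s'" using q'1 q'2 by (metis lessThan_iff sum_nonneg)
      with False have s': "0 < s'" by simp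
      let ?F = "{j. j < N \<and> 0 < q j \<and> real m * q j < s}"
      let ?F' = "{j. j < N \<and> 0 < q' j \<and> real m * q' j < s'}"
      have mr: "0 < real m * r" using r assms(1) by simp
      have "?F' \<subseteq> ?F"
        using r mr by (auto simp: q'_def s'_def algebra_simps split: if_splits)
      moreover have "\<exists>j. j \<in> ?F \<and> j \<notin> ?F'"
      proof -
        have "r \<in> V" using V Min_in unfolding r_def by blast
        then consider j where "j \<in> S" "r = q j"
          | j where "j < N" "j \<notin> S" "r = (s - real m * q j) / real m"
          by (auto simp: V_def)
        \<comment> \<open>If the minimum is attained in \<open>S\<close>, that index drops to 0, and
          \<open>s' > 0\<close> shows that it was below the old cap. If it is attained outside
          \<open>S\<close>, that index meets the new cap, which lies below the old one.\<close>
        then show ?thesis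
        proof cases
          case 1
          then show ?thesis using r s' SN by (intro exI[of _ j]) (auto simp: q'_def s'_def)
        next
          case 2
          then have "real m * q j = s'" using assms(1) by (simp add: s'_def)
          moreover have "0 < q j" using calculation s' by (metis mult_nonneg_nonpos2 mult.commute not_less of_nat_0_le_iff)
          ultimately show ?thesis
            using 2 mr by (intro exI[of _ j]) (auto simp: q'_def s'_def)
        qed
      qed
      ultimately have "?F' \<subset> ?F" by blast
      then have "card ?F' < card ?F" by (intro psubset_card_mono) auto
      from less.hyps[OF this q'1 q'2] show ?thesis by blast
    qed
    then obtain L :: nat and R A where
      RA: "\<forall>l<L. 0 < R l \<and> A l \<subseteq> {..<N} \<and> card (A l) = m"
      and dec: "\<forall>j<N. q' j = (\<Sum>l<L. if j \<in> A l then R l else 0)"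
      by blast
    have "q j = (\<Sum>l<Suc L. if j \<in> (A(L := S)) l then (R(L := r)) l else 0)" if "j < N" for j
    proof -
      have "(\<Sum>l<L. if j \<in> (A(L := S)) l then (R(L := r)) l else 0) = q' j"
        unfolding dec[rule_format, OF that] by (intro sum.cong) auto
      then show ?thesis by (simp add: q'_def)
    qed
    moreover have "\<forall>l<Suc L. 0 < (R(L := r)) l \<and> (A(L := S)) l \<subseteq> {..<N} \<and> card ((A(L := S)) l) = m"
      using RA r SN S(3) by (auto simp: less_Suc_eq)
    ultimately show ?thesis by blast
  qed
qed

lemma sum_nth_eq_sum_list:
  fixes f :: "'a \<Rightarrow> 'b::comm_monoid_add"
  shows "(\<Sum>l<length xs. f (xs ! l)) = (\<Sum>x\<leftarrow>xs. f x)"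
  by (simp add: sum_list_sum_nth lessThan_atLeast0)

lemma max_coherent_vec_carrier [simp]: "max_coherent_vec m \<in> carrier_vec m"
  by (simp add: max_coherent_vec_def)

lemma ketbra_max_coherent_entry:
  assumes "a < m" "b < m"
  shows "ketbra (max_coherent_vec m) $$ (a, b) = 1 / of_nat m"
proof -
  have "complex_of_real (1 / sqrt (real m)) * complex_of_real (1 / sqrt (real m)) = 1 / of_nat m"
    by (simp flip: of_real_mult)
  then show ?thesis
    using assms by (simp add: ketbra_entry[OF max_coherent_vec_carrier]) (simp add: max_coherent_vec_def)
qed

lemma kraus_map_ketbra:
  assumes "set Ks \<subseteq> carrier_mat m n" "v \<in> carrier_vec n" "a < m" "b < m"
  shows "kraus_map m Ks (ketbra v) $$ (a, b)
    = (\<Sum>K\<leftarrow>Ks. (\<Sum>i<n. K $$ (a, i) * v $ i) * cnj (\<Sum>i<n. K $$ (b, i) * v $ i))"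
proof -
  have "kraus_map m Ks (ketbra v) $$ (a, b)
    = (\<Sum>l<length Ks. (\<Sum>i<n. (Ks ! l) $$ (a, i) * v $ i) * cnj (\<Sum>i<n. (Ks ! l) $$ (b, i) * v $ i))"
    using assms by (simp add: kraus_map_entry ketbra_entry sum_product mult_ac)
  then show ?thesis by (simp only: sum_nth_eq_sum_list[where f = "\<lambda>K. (\<Sum>i<n. K $$ (a, i) * v $ i) * cnj (\<Sum>i<n. K $$ (b, i) * v $ i)"])
qed

text \<open>If \<open>|v\<^sub>j|\<^sup>2\<close> is the sum of the weights \<open>r\<close> of the sets \<open>S\<close> containing \<open>j\<close>, each of size \<open>m\<close>, then the
  operators \<open>selection_op m v r S\<close> send \<open>v\<close> to multiples of the maximally coherent vector and are jointly
  trace preserving on the support of \<open>v\<close>; \<open>reset_op\<close> takes care of the rest of the basis.\<close>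

definition selection_op :: "nat \<Rightarrow> complex vec \<Rightarrow> real \<Rightarrow> nat set \<Rightarrow> complex mat" where
  "selection_op m v r S = mat m (dim_vec v)
     (\<lambda>(a, j). if sorted_list_of_set S ! a = j then complex_of_real (sqrt r) / v $ j else 0)"

definition reset_op :: "nat \<Rightarrow> nat \<Rightarrow> nat \<Rightarrow> complex mat" where
  "reset_op m n i = mat m n (\<lambda>(a, j). if a = 0 \<and> j = i then 1 else 0)"

lemma sum_sorted_list_of_set:
  fixes g :: "nat \<Rightarrow> 'a::comm_monoid_add"
  assumes "finite S"
  shows "(\<Sum>a<card S. g (sorted_list_of_set S ! a)) = sum g S"
  using assms by (intro sum.reindex_bij_betw bij_betw_nth) auto

lemma partial_injection_selection_op:
  assumes "finite S" "card S = m"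
  shows "partial_injection (selection_op m v r S)"
  using assms by (auto simp: partial_injection_def selection_op_def nth_eq_iff_index_eq split: if_splits)

lemma partial_injection_reset_op: "partial_injection (reset_op m n i)"
  by (auto simp: partial_injection_def reset_op_def)

text \<open>Serves to make the set of attainable values nonempty, since \<open>Sup\<close> of the
  empty set says nothing. The witness measures in the reference basis and prepares the first basis
  state.\<close>

lemma free_reset:
  assumes "\<O> \<in> {MIO, DIO, IO, SIO}" "1 \<le> m"
  shows "\<O> n m \<noteq> {}"
proof -
  let ?Ks = "map (reset_op m n) [0..<n]"
  have "kraus_map m ?Ks \<in> \<O> n m"
  proof (rule kraus_map_free[OF _ _ _ assms(1)])
    fix i assume i: "i < n"
    have "(\<Sum>l<length ?Ks. \<Sum>a<m. (cmod ((?Ks ! l) $$ (a, i)))\<^sup>2)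
        = (\<Sum>l<n. \<Sum>a<m. if a = 0 \<and> l = i then 1 else 0)"
      using i by (auto simp: reset_op_def intro!: sum.cong)
    also have "\<dots> = (\<Sum>l<n. if l = i then 1 else 0)"
      using assms(2) by (intro sum.cong refl) (auto simp: if_distrib sum.delta)
    finally show "(\<Sum>l<length ?Ks. \<Sum>a<m. (cmod ((?Ks ! l) $$ (a, i)))\<^sup>2) = 1"
      using i by simp
  qed (auto simp: reset_op_def partial_injection_reset_op[unfolded reset_op_def])
  then show ?thesis by blast
qed

lemma pure_state_distillation:
  assumes \<O>: "\<O> \<in> {MIO, DIO, IO, SIO}" and v: "v \<in> unit_vecs n" and m: "1 \<le> m"
    and cap: "\<And>j. j < n \<Longrightarrow> real m * (cmod (v $ j))\<^sup>2 \<le> 1"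
  shows "\<exists>E \<in> \<O> n m. E (ketbra v) = ketbra (max_coherent_vec m)"
proof -
  have vc: "v \<in> carrier_vec n" and v1: "(\<Sum>j<n. (cmod (v $ j))\<^sup>2) = 1"
    using v by (auto simp: unit_vecs_iff)
  obtain L :: nat and r S where rS: "\<And>l. l < L \<Longrightarrow> 0 < r l \<and> S l \<subseteq> {..<n} \<and> card (S l) = m"
    and dec: "\<And>j. j < n \<Longrightarrow> (cmod (v $ j))\<^sup>2 = (\<Sum>l<L. if j \<in> S l then r l else 0)"
    using capped_simplex_decomposition[of m n "\<lambda>j. (cmod (v $ j))\<^sup>2" 1] cap v1 m by auto
  have finS: "finite (S l)" if "l < L" for l
    using rS[OF that] finite_subset by blast
  have supp: "v $ j \<noteq> 0" if "l < L" "j \<in> S l" for l j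
  proof -
    have "j < n" using rS[OF that(1)] that(2) by blast
    have "(if j \<in> S l then r l else 0) \<le> (\<Sum>l<L. if j \<in> S l then r l else 0)"
      by (rule member_le_sum) (use rS that in \<open>auto simp: less_imp_le\<close>)
    then have "0 < (cmod (v $ j))\<^sup>2"
      using dec[OF \<open>j < n\<close>] rS[OF that(1)] that(2) by simp
    then show ?thesis by auto
  qed
  \<comment> \<open>Double counting: every set covers \<open>m\<close> indices. The total weight
    \<open>1 / m\<close> reappears as the common value of all entries of the output.\<close>
  have "1 = (\<Sum>j<n. \<Sum>l<L. if j \<in> S l then r l else 0)"
    using v1 dec by simp
  also have "\<dots> = (\<Sum>l<L. \<Sum>j<n. if j \<in> S l then r l else 0)" by (rule sum.swap)
  also have "\<dots> = (\<Sum>l<L. real m * r l)"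
    using rS by (intro sum.cong refl) (simp add: sum.If_cases Int_absorb1)
  finally have sumr: "(\<Sum>l<L. r l) = 1 / real m"
    using m by (simp add: field_simps flip: sum_distrib_left)
  define Z where "Z = filter (\<lambda>j. v $ j = 0) [0..<n]"
  define Ks where "Ks = map (\<lambda>l. selection_op m v (r l) (S l)) [0..<L] @ map (reset_op m n) Z"
  have Ks_sum: "(\<Sum>K\<leftarrow>Ks. f K) = (\<Sum>l<L. f (selection_op m v (r l) (S l))) + (\<Sum>j\<in>{j. j < n \<and> v $ j = 0}. f (reset_op m n j))"
    for f :: "complex mat \<Rightarrow> 'a::comm_monoid_add"
    by (simp add: Ks_def Z_def comp_def sum_list_distinct_conv_sum_set lessThan_atLeast0)
  have Ks: "set Ks \<subseteq> carrier_mat m n"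
    using vc by (auto simp: Ks_def selection_op_def reset_op_def)
  have sel_sum: "(\<Sum>a<m. if sorted_list_of_set (S l) ! a = i then c else 0) = (if i \<in> S l then c else 0)"
    if "l < L" for l i and c :: real
    using sum_sorted_list_of_set[OF finS[OF that], of "\<lambda>x. if x = i then c else 0"] rS[OF that] finS[OF that]
    by simp
  have sel_apply: "(\<Sum>i<n. selection_op m v (r l) (S l) $$ (a, i) * v $ i) = complex_of_real (sqrt (r l))"
    if "l < L" "a < m" for l a
  proof -
    define j where "j = sorted_list_of_set (S l) ! a"
    have jS: "j \<in> S l"
      using rS[OF that(1)] finS[OF that(1)] that(2) nth_mem[of a "sorted_list_of_set (S l)"] by (simp add: j_def)
    then have j: "j < n" using rS[OF that(1)] by blast
    have "(\<Sum>i<n. selection_op m v (r l) (S l) $$ (a, i) * v $ i)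
        = (\<Sum>i<n. if i = j then complex_of_real (sqrt (r l)) else 0)"
      using vc that supp[OF that(1) jS] by (intro sum.cong refl) (auto simp: selection_op_def j_def)
    then show ?thesis using j by simp
  qed
  have reset_apply: "(\<Sum>i<n. reset_op m n j $$ (a, i) * v $ i) = 0" if "v $ j = 0" "a < m" for j a
    using that by (intro sum.neutral) (auto simp: reset_op_def)
  have "kraus_map m Ks \<in> \<O> n m"
  proof (rule kraus_map_free[OF Ks _ _ \<O>])
    fix K assume "K \<in> set Ks"
    then show "partial_injection K"
      using rS finS by (auto simp: Ks_def partial_injection_selection_op partial_injection_reset_op)
  next
    fix i assume i: "i < n"
    have "(\<Sum>l<length Ks. \<Sum>a<m. (cmod ((Ks ! l) $$ (a, i)))\<^sup>2)
        = (\<Sum>l<L. \<Sum>a<m. (cmod (selection_op m v (r l) (S l) $$ (a, i)))\<^sup>2)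
          + (\<Sum>j\<in>{j. j < n \<and> v $ j = 0}. \<Sum>a<m. (cmod (reset_op m n j $$ (a, i)))\<^sup>2)"
      by (simp only: sum_nth_eq_sum_list[where f = "\<lambda>K. \<Sum>a<m. (cmod (K $$ (a, i)))\<^sup>2"] Ks_sum)
    also have "(\<Sum>l<L. \<Sum>a<m. (cmod (selection_op m v (r l) (S l) $$ (a, i)))\<^sup>2)
        = (\<Sum>l<L. if i \<in> S l then r l / (cmod (v $ i))\<^sup>2 else 0)"
    proof (intro sum.cong refl)
      fix l assume l: "l \<in> {..<L}"
      have "(\<Sum>a<m. (cmod (selection_op m v (r l) (S l) $$ (a, i)))\<^sup>2)
          = (\<Sum>a<m. if sorted_list_of_set (S l) ! a = i then r l / (cmod (v $ i))\<^sup>2 else 0)"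
        using i vc l rS[of l]
        by (intro sum.cong refl) (auto simp: selection_op_def norm_divide power_divide less_imp_le)
      then show "(\<Sum>a<m. (cmod (selection_op m v (r l) (S l) $$ (a, i)))\<^sup>2)
          = (if i \<in> S l then r l / (cmod (v $ i))\<^sup>2 else 0)"
        using l sel_sum by simp
    qed
    \<comment> \<open>Off the support of \<open>v\<close> this quotient is \<open>0 / 0 = 0\<close>,
      and the reset operators supply the missing 1.\<close>
    also have "\<dots> = (cmod (v $ i))\<^sup>2 / (cmod (v $ i))\<^sup>2"
      unfolding dec[OF i] sum_divide_distrib by (intro sum.cong refl) auto
    also have "(\<Sum>j\<in>{j. j < n \<and> v $ j = 0}. \<Sum>a<m. (cmod (reset_op m n j $$ (a, i)))\<^sup>2)
        = (\<Sum>j\<in>{j. j < n \<and> v $ j = 0}. if j = i then 1 else 0)"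
    proof (intro sum.cong refl)
      fix j
      have "(\<Sum>a<m. (cmod (reset_op m n j $$ (a, i)))\<^sup>2) = (\<Sum>a<m. if a = 0 then (if j = i then 1 else 0) else 0)"
        using i by (intro sum.cong refl) (auto simp: reset_op_def)
      then show "(\<Sum>a<m. (cmod (reset_op m n j $$ (a, i)))\<^sup>2) = (if j = i then 1 else 0)"
        using m by simp
    qed
    finally show "(\<Sum>l<length Ks. \<Sum>a<m. (cmod ((Ks ! l) $$ (a, i)))\<^sup>2) = 1"
      using i by (cases "v $ i = 0") auto
  qed
  moreover have "kraus_map m Ks (ketbra v) = ketbra (max_coherent_vec m)"
  proof (rule eq_matI)
    fix a b assume "a < dim_row (ketbra (max_coherent_vec m))" "b < dim_col (ketbra (max_coherent_vec m))"
    then have ab: "a < m" "b < m" by (auto simp: ketbra_def max_coherent_vec_def)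
    have "kraus_map m Ks (ketbra v) $$ (a, b) = (\<Sum>l<L. complex_of_real (sqrt (r l)) * complex_of_real (sqrt (r l)))"
      unfolding kraus_map_ketbra[OF Ks vc ab] Ks_sum using ab by (simp add: sel_apply reset_apply)
    also have "\<dots> = (\<Sum>l<L. complex_of_real (r l))"
      using rS by (intro sum.cong refl) (simp add: less_imp_le flip: of_real_mult)
    also have "\<dots> = 1 / of_nat m"
      by (simp add: sumr flip: of_real_sum)
    finally show "kraus_map m Ks (ketbra v) $$ (a, b) = ketbra (max_coherent_vec m) $$ (a, b)"
      using ab by (simp add: ketbra_max_coherent_entry)
  qed (use carrier_matD[OF kraus_map_carrier] in \<open>auto simp: ketbra_def max_coherent_vec_def\<close>)
  ultimately show ?thesis by blast
qed

section \<open>Decompositions into pure states with equal diagonals\<close>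

lemma exists_unit_orthogonal:
  fixes c :: complex
  shows "\<exists>e. cmod e = 1 \<and> Re (c * e) = 0"
proof (cases "c = 0")
  case False
  have "c * (\<i> * cnj c / of_real (cmod c)) = \<i> * (c * cnj c) / of_real (cmod c)"
    by simp
  also have "\<dots> = \<i> * of_real (cmod c)"
    using False by (simp add: complex_norm_square[symmetric] power2_eq_square)
  finally have "c * (\<i> * cnj c / of_real (cmod c)) = \<i> * of_real (cmod c)" .
  then have "Re (c * (\<i> * cnj c / of_real (cmod c))) = 0" by simp
  then show ?thesis
    using False by (intro exI[of _ "\<i> * cnj c / of_real (cmod c)"]) (simp add: norm_mult norm_divide)
qed (auto intro: exI[of _ 1])

text \<open>The equation for \<open>r\<close> is also satisfied by \<open>- (1 / r)\<close>, so a
  single condition on \<open>t\<close> makes the entry unimodular for both parameters. The extra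
  factor \<open>a\<close> in that condition keeps the case \<open>a = 0\<close>
  unconstrained.\<close>

lemma cmod_shift_eq_1:
  assumes x: "(cmod x)\<^sup>2 + a\<^sup>2 = 1" and e: "cmod e = 1"
    and r: "r\<^sup>2 - 1 = 2 * r * t" and t: "a * (a * t + Re (x * e)) = 0"
  shows "cmod (cnj x + of_real (a * r) * e) = 1"
proof -
  have e': "(Re e)\<^sup>2 + (Im e)\<^sup>2 = 1" using e by (simp add: cmod_def)
  have "(cmod (cnj x + of_real (a * r) * e))\<^sup>2
      = (cmod x)\<^sup>2 + a\<^sup>2 * r\<^sup>2 * ((Re e)\<^sup>2 + (Im e)\<^sup>2) + 2 * a * r * Re (x * e)"
    unfolding cmod_power2 by (simp add: power2_eq_square algebra_simps)
  also have "\<dots> = (cmod x)\<^sup>2 + a\<^sup>2 + a\<^sup>2 * (r\<^sup>2 - 1) + 2 * a * r * Re (x * e)"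
    unfolding e' by (simp add: algebra_simps)
  also have "\<dots> = (cmod x)\<^sup>2 + a\<^sup>2 + 2 * r * (a * (a * t + Re (x * e)))"
    unfolding r by (simp add: algebra_simps power2_eq_square)
  finally have "(cmod (cnj x + of_real (a * r) * e))\<^sup>2 = 1" using x t by simp
  then show ?thesis using power2_eq_iff_nonneg[of "cmod (cnj x + of_real (a * r) * e)" 1] by simp
qed

text \<open>The correlation matrix with entries \<open>x\<close>, \<open>y\<close>, \<open>cnj x * y + a * b * \<omega>\<close> has rank at most 2. Among the
  vectors \<open>(1, cnj x + a * s, cnj y + b * cnj \<omega> * s)\<close> in its range, two with unimodular entries
  have parameters of the form \<open>s = r * e\<close> and \<open>s = - e / r\<close> with \<open>|e| = 1\<close>; the weights make \<open>s\<close> have mean 0 and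
  variance 1.\<close>

lemma phase_mixture_boundary:
  fixes x y \<omega> :: complex and a b :: real
  assumes x: "(cmod x)\<^sup>2 + a\<^sup>2 = 1" and y: "(cmod y)\<^sup>2 + b\<^sup>2 = 1" and \<omega>: "cmod \<omega> = 1"
  obtains p q :: real and u u' v v' where
    "0 \<le> p" "0 \<le> q" "p + q = 1" "cmod u = 1" "cmod u' = 1" "cmod v = 1" "cmod v' = 1"
    "p * cnj u + q * cnj u' = x" "p * cnj v + q * cnj v' = y"
    "p * (u * cnj v) + q * (u' * cnj v') = cnj x * y + of_real (a * b) * \<omega>"
proof -
  \<comment> \<open>For nonzero \<open>a\<close> and \<open>b\<close>, unimodularity of the two
    entries prescribes \<open>t = - Re (x * e) / a\<close> and
    \<open>t = - Re (y * cnj \<omega> * e) / b\<close>. The direction \<open>e\<close> is chosen to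
    make these values agree.\<close>
  obtain e where e: "cmod e = 1" and orth: "Re ((b * x - a * (y * cnj \<omega>)) * e) = 0"
    using exists_unit_orthogonal by blast
  have orth': "b * Re (x * e) = a * Re (y * cnj \<omega> * e)"
    using orth by (simp add: algebra_simps)
  obtain t where t1: "a * (a * t + Re (x * e)) = 0" and t2: "b * (b * t + Re (y * (cnj \<omega> * e))) = 0"
  \<comment> \<open>If \<open>a = 0\<close>, only the second condition restricts \<open>t\<close>;
    if \<open>b = 0\<close> as well, the quotient is 0 and any value would do.\<close>
  proof (cases "a = 0")
    case True
    then show ?thesis
      by (intro that[of "- Re (y * (cnj \<omega> * e)) / b"]) (cases "b = 0"; simp)+
  next
    case False
    have "b * (b * (- Re (x * e) / a) + Re (y * (cnj \<omega> * e)))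
        = b / a * (a * Re (y * cnj \<omega> * e) - b * Re (x * e))"
      using False by (simp add: field_simps)
    also have "\<dots> = 0" using orth' by simp
    finally show ?thesis
      using False by (intro that[of "- Re (x * e) / a"]) auto
  qed
  \<comment> \<open>The positive root of \<open>r\<^sup>2 - 2 * t * r - 1 = 0\<close>; the roots
    have product -1, so the other one is \<open>- (1 / r)\<close>.\<close>
  define r where "r = t + sqrt (t\<^sup>2 + 1)"
  have "\<bar>t\<bar> < sqrt (t\<^sup>2 + 1)" by (rule real_less_rsqrt) simp
  then have r0: "0 < r" by (simp add: r_def)
  have r: "r\<^sup>2 - 1 = 2 * r * t"
  proof -
    define s where "s = sqrt (t\<^sup>2 + 1)"
    have "s * s = t * t + 1" by (simp add: s_def power2_eq_square)
    then show ?thesis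
      unfolding r_def s_def[symmetric] power2_eq_square by (simp add: algebra_simps)
  qed
  have r': "(- (1 / r))\<^sup>2 - 1 = 2 * (- (1 / r)) * t"
  proof -
    have "(- (1 / r))\<^sup>2 - 1 = - (r\<^sup>2 - 1) / r\<^sup>2"
      using r0 by (simp add: field_simps power2_eq_square)
    also have "\<dots> = 2 * (- (1 / r)) * t"
      unfolding r using r0 by (simp add: power2_eq_square)
    finally show ?thesis .
  qed
  define p q where "p = 1 / (1 + r\<^sup>2)" and "q = r\<^sup>2 / (1 + r\<^sup>2)"
  have pos: "0 < 1 + r\<^sup>2" by (simp add: add_pos_nonneg)
  have pq: "p + q = 1" "p * r = q * (1 / r)" "p * r\<^sup>2 + q * (1 / r)\<^sup>2 = 1"
    using r0 pos by (simp_all add: p_def q_def power2_eq_square add_divide_distrib[symmetric] add.commute)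
  define R R' P Q A B where "R = complex_of_real r" and "R' = complex_of_real (1 / r)"
    and "P = complex_of_real p" and "Q = complex_of_real q"
    and "A = complex_of_real a" and "B = complex_of_real b"
  have PQ: "P + Q = 1" "P * R = Q * R'" "P * R\<^sup>2 + Q * R'\<^sup>2 = 1"
  proof -
    have "complex_of_real (p + q) = 1" "complex_of_real (p * r) = of_real (q * (1 / r))"
      "complex_of_real (p * r\<^sup>2 + q * (1 / r)\<^sup>2) = 1"
      by (simp_all only: pq of_real_1)
    then show "P + Q = 1" "P * R = Q * R'" "P * R\<^sup>2 + Q * R'\<^sup>2 = 1"
      unfolding P_def Q_def R_def R'_def
      by (simp_all only: of_real_add of_real_mult of_real_power)
  qed
  have ee: "e * cnj e = 1" "\<omega> * cnj \<omega> = 1"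
    using complex_norm_square[of e] complex_norm_square[of \<omega>] e \<omega> by simp_all
  have cnj_real [simp]: "cnj R = R" "cnj R' = R'" "cnj A = A" "cnj B = B"
    by (simp_all add: R_def R'_def A_def B_def)
  define u u' v v' where "u = cnj x + A * R * e" and "u' = cnj x - A * R' * e"
    and "v = cnj y + B * R * (cnj \<omega> * e)" and "v' = cnj y - B * R' * (cnj \<omega> * e)"
  have \<omega>e: "cmod (cnj \<omega> * e) = 1" using e \<omega> by (simp add: norm_mult)
  show thesis
  proof (rule that[of p q u u' v v'])
    show "0 \<le> p" "0 \<le> q" "p + q = 1" using pos pq by (auto simp: p_def q_def)
    show "cmod u = 1" "cmod v = 1"
      using cmod_shift_eq_1[OF x e r t1] cmod_shift_eq_1[OF y \<omega>e r t2]
      by (simp_all add: u_def v_def A_def B_def R_def)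
    show "cmod u' = 1" "cmod v' = 1"
      using cmod_shift_eq_1[OF x e r' t1] cmod_shift_eq_1[OF y \<omega>e r' t2]
      by (simp_all add: u'_def v'_def A_def B_def R'_def)
    have "P * cnj u + Q * cnj u' = (P + Q) * x + (P * R - Q * R') * (A * cnj e)"
      by (simp add: u_def u'_def algebra_simps)
    then show "p * cnj u + q * cnj u' = x" using PQ by (simp add: P_def Q_def)
    have "P * cnj v + Q * cnj v' = (P + Q) * y + (P * R - Q * R') * (B * (\<omega> * cnj e))"
      by (simp add: v_def v'_def algebra_simps)
    then show "p * cnj v + q * cnj v' = y" using PQ by (simp add: P_def Q_def)
    have "P * (u * cnj v) + Q * (u' * cnj v') = (P + Q) * (cnj x * y)
        + (P * R - Q * R') * (cnj x * B * \<omega> * cnj e + A * e * y)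
        + (P * R\<^sup>2 + Q * R'\<^sup>2) * A * B * \<omega> * (e * cnj e)"
      by (simp add: u_def u'_def v_def v'_def algebra_simps power2_eq_square)
    then show "p * (u * cnj v) + q * (u' * cnj v') = cnj x * y + of_real (a * b) * \<omega>"
      using PQ ee by (simp add: P_def Q_def A_def B_def)
  qed
qed

text \<open>The two points are the ends of a diameter through \<open>w\<close>.\<close>

lemma unit_disc_mixture:
  fixes w :: complex
  assumes "cmod w \<le> 1"
  obtains p q :: real and \<omega> \<omega>' :: complex where "0 \<le> p" "0 \<le> q" "p + q = 1" "cmod \<omega> = 1" "cmod \<omega>' = 1"
    "w = p * \<omega> + q * \<omega>'"
proof -
  obtain s :: complex where s: "cmod s = 1" "w = cmod w * s"
    by (cases "w = 0") (auto intro: that[of 1] that[of "w / of_real (cmod w)"] simp: norm_divide)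
  have "w = ((1 + cmod w) / 2) * s + ((1 - cmod w) / 2) * (- s)"
    by (subst s(2)) (simp add: field_simps)
  then show thesis
    using assms s(1) by (intro that[of "(1 + cmod w) / 2" "(1 - cmod w) / 2" s "- s"]) (auto simp: field_simps)
qed

text \<open>The last entry of a \<open>3 \<times> 3\<close> correlation matrix ranges over a disc, and every point of a disc is a
  mixture of two boundary points.\<close>

lemma phase_mixture:
  assumes x: "cmod x \<le> 1" and y: "cmod y \<le> 1"
    and z: "(cmod (z - cnj x * y))\<^sup>2 \<le> (1 - (cmod x)\<^sup>2) * (1 - (cmod y)\<^sup>2)"
  obtains p :: "nat \<Rightarrow> real" and u v :: "nat \<Rightarrow> complex" where
    "\<And>i. i < 4 \<Longrightarrow> 0 \<le> p i \<and> cmod (u i) = 1 \<and> cmod (v i) = 1"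
    "(\<Sum>i<4. p i) = 1" "(\<Sum>i<4. p i * cnj (u i)) = x" "(\<Sum>i<4. p i * cnj (v i)) = y"
    "(\<Sum>i<4. p i * (u i * cnj (v i))) = z"
proof -
  define a b where "a = sqrt (1 - (cmod x)\<^sup>2)" and "b = sqrt (1 - (cmod y)\<^sup>2)"
  have sq: "(cmod x)\<^sup>2 \<le> 1" "(cmod y)\<^sup>2 \<le> 1"
    using x y by (simp_all add: power_le_one)
  then have a: "(cmod x)\<^sup>2 + a\<^sup>2 = 1" and b: "(cmod y)\<^sup>2 + b\<^sup>2 = 1"
    by (simp_all add: a_def b_def)
  have ab0: "0 \<le> a * b" using sq by (simp add: a_def b_def)
  have "(cmod (z - cnj x * y))\<^sup>2 \<le> (a * b)\<^sup>2"
    using z sq by (simp add: a_def b_def power_mult_distrib)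
  then have zab: "cmod (z - cnj x * y) \<le> a * b" using ab0 by (rule power2_le_imp_le)
  \<comment> \<open>If \<open>a * b = 0\<close>, the quotient is 0, and \<open>zab\<close> has
    already forced \<open>z = cnj x * y\<close>.\<close>
  define w where "w = (z - cnj x * y) / of_real (a * b)"
  have w: "cmod w \<le> 1"
    using zab ab0 by (cases "a * b = 0") (auto simp: w_def norm_divide divide_le_eq abs_of_nonneg simp flip: of_real_mult)
  have zw: "z = cnj x * y + of_real (a * b) * w"
    using zab by (cases "a * b = 0") (auto simp: w_def simp flip: of_real_mult)
  obtain g h and \<omega> \<omega>' :: complex where gh: "0 \<le> g" "0 \<le> h" "g + h = 1" "cmod \<omega> = 1" "cmod \<omega>' = 1"
    "w = complex_of_real g * \<omega> + complex_of_real h * \<omega>'"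
    using unit_disc_mixture[OF w] by blast
  \<comment> \<open>The two boundary matrices differ only in the last entry, so mixing their
    decompositions with weights \<open>g\<close> and \<open>h\<close> preserves \<open>x\<close> and
    \<open>y\<close>.\<close>
  obtain p1 p2 :: real and u1 u2 v1 v2 where 1:
    "0 \<le> p1" "0 \<le> p2" "p1 + p2 = 1" "cmod u1 = 1" "cmod u2 = 1" "cmod v1 = 1" "cmod v2 = 1"
    "p1 * cnj u1 + p2 * cnj u2 = x" "p1 * cnj v1 + p2 * cnj v2 = y"
    "p1 * (u1 * cnj v1) + p2 * (u2 * cnj v2) = cnj x * y + of_real (a * b) * \<omega>"
    by (rule phase_mixture_boundary[OF a b gh(4)], rule that)
  obtain p3 p4 :: real and u3 u4 v3 v4 where 2:
    "0 \<le> p3" "0 \<le> p4" "p3 + p4 = 1" "cmod u3 = 1" "cmod u4 = 1" "cmod v3 = 1" "cmod v4 = 1"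
    "p3 * cnj u3 + p4 * cnj u4 = x" "p3 * cnj v3 + p4 * cnj v4 = y"
    "p3 * (u3 * cnj v3) + p4 * (u4 * cnj v4) = cnj x * y + of_real (a * b) * \<omega>'"
    by (rule phase_mixture_boundary[OF a b gh(5)], rule that)
  define G H where "G = complex_of_real g" and "H = complex_of_real h"
  have GH: "G + H = 1" using gh(3) by (simp add: G_def H_def flip: of_real_add)
  have combine: "complex_of_real (g * p1) * c1 + complex_of_real (g * p2) * c2
      + complex_of_real (h * p3) * c3 + complex_of_real (h * p4) * c4 = G * c + H * c'"
    if "complex_of_real p1 * c1 + complex_of_real p2 * c2 = c"
      and "complex_of_real p3 * c3 + complex_of_real p4 * c4 = c'" for c1 c2 c3 c4 c c'
    by (simp add: that[symmetric] G_def H_def algebra_simps)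
  have same: "G * c + H * c = c" for c
    using GH by (simp flip: distrib_right)
  have 4: "{..<4} = {0, 1, 2, 3::nat}" by auto
  have gp: "g * p1 + g * p2 + h * p3 + h * p4 = 1"
  proof -
    have "g * p1 + g * p2 + h * p3 + h * p4 = g * (p1 + p2) + h * (p3 + p4)"
      by (simp add: algebra_simps)
    then show ?thesis using 1(3) 2(3) gh(3) by simp
  qed
  show thesis
  proof (rule that[of "\<lambda>i. [g * p1, g * p2, h * p3, h * p4] ! i"
        "\<lambda>i. [u1, u2, u3, u4] ! i" "\<lambda>i. [v1, v2, v3, v4] ! i"])
    fix i :: nat assume "i < 4"
    then have "i \<in> {0, 1, 2, 3}" by auto
    then show "0 \<le> [g * p1, g * p2, h * p3, h * p4] ! i \<and> cmod ([u1, u2, u3, u4] ! i) = 1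
        \<and> cmod ([v1, v2, v3, v4] ! i) = 1"
      using 1 2 gh by auto
  next
    show "(\<Sum>i<4. [g * p1, g * p2, h * p3, h * p4] ! i) = 1"
      using gp by (simp add: 4 add.assoc)
    show "(\<Sum>i<4. complex_of_real ([g * p1, g * p2, h * p3, h * p4] ! i) * cnj ([u1, u2, u3, u4] ! i)) = x"
      using combine[OF 1(8) 2(8)] same by (simp add: 4 add.assoc)
    show "(\<Sum>i<4. complex_of_real ([g * p1, g * p2, h * p3, h * p4] ! i) * cnj ([v1, v2, v3, v4] ! i)) = y"
      using combine[OF 1(9) 2(9)] same by (simp add: 4 add.assoc)
    have "G * (cnj x * y + of_real (a * b) * \<omega>) + H * (cnj x * y + of_real (a * b) * \<omega>')
        = (G * (cnj x * y) + H * (cnj x * y)) + of_real (a * b) * (G * \<omega> + H * \<omega>')"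
      by (simp add: algebra_simps)
    then have "G * (cnj x * y + of_real (a * b) * \<omega>) + H * (cnj x * y + of_real (a * b) * \<omega>') = z"
      unfolding same by (simp only: zw gh(6) G_def H_def)
    then show "(\<Sum>i<4. complex_of_real ([g * p1, g * p2, h * p3, h * p4] ! i)
        * ([u1, u2, u3, u4] ! i * cnj ([v1, v2, v3, v4] ! i))) = z"
      using combine[OF 1(10) 2(10)] by (simp add: 4 add.assoc)
  qed
qed

section \<open>Positive forms in three variables\<close>

text \<open>Taking \<open>\<beta> = c\<close> and \<open>t = - p\<close> gives
  \<open>0 \<le> p * (p * r - |c|^2)\<close>, which settles \<open>p > 0\<close>. Real
  \<open>t\<close> is general enough because a common phase of both variables leaves the form
  unchanged.\<close>

lemma psd_form_minor:
  fixes c :: complex and p r :: real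
  assumes form: "\<And>\<beta> t. 0 \<le> p * (cmod \<beta>)\<^sup>2 + r * t\<^sup>2 + 2 * t * Re (c * cnj \<beta>)"
  shows "(cmod c)\<^sup>2 \<le> p * r"
proof -
  have cc: "Re (c * cnj (of_real k * c)) = k * (cmod c)\<^sup>2" for k
    unfolding cmod_power2 by (simp add: algebra_simps power2_eq_square)
  have F: "0 \<le> p * (k\<^sup>2 * (cmod c)\<^sup>2) + r * t\<^sup>2 + 2 * t * (k * (cmod c)\<^sup>2)" for k t
    using form[of "of_real k * c" t] unfolding cc by (simp add: norm_mult power_mult_distrib)
  have "0 \<le> p" using form[of 1 0] by simp
  show ?thesis
  proof (cases "p = 0")
    case True
    \<comment> \<open>With \<open>p = 0\<close> the form is affine in \<open>k\<close>, and for
      \<open>c \<noteq> 0\<close> it would take the value -1 at the chosen point.\<close>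
    have "c = 0"
      using F[of "- (r + 1) / (2 * (cmod c)\<^sup>2)" 1] True by (cases "c = 0") (auto simp: field_simps)
    then show ?thesis using True by simp
  next
    case False
    have "0 \<le> p * (p * r - (cmod c)\<^sup>2)"
      using F[of 1 "- p"] by (simp add: algebra_simps power2_eq_square)
    then show ?thesis using False \<open>0 \<le> p\<close> by (simp add: zero_le_mult_iff)
  qed
qed

text \<open>Dividing by the square roots of the diagonal reduces the claim to a correlation matrix.
  The overall phase of each vector is free, so the first components can be the real constant
  \<open>A\<close>.\<close>

lemma hermitian_form_mixture:
  fixes a b c :: real and x y z :: complex
  assumes form: "\<And>\<alpha> \<beta> \<gamma>. 0 \<le> a * (cmod \<alpha>)\<^sup>2 + b * (cmod \<beta>)\<^sup>2 + c * (cmod \<gamma>)\<^sup>2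
      + 2 * Re (x * \<beta> * cnj \<alpha>) + 2 * Re (y * \<gamma> * cnj \<alpha>) + 2 * Re (z * \<gamma> * cnj \<beta>)"
  obtains p :: "nat \<Rightarrow> real" and u v w :: "nat \<Rightarrow> complex" where
    "\<And>i. i < 4 \<Longrightarrow> 0 \<le> p i \<and> (cmod (u i))\<^sup>2 = a \<and> (cmod (v i))\<^sup>2 = b \<and> (cmod (w i))\<^sup>2 = c"
    "(\<Sum>i<4. p i) = 1"
    "(\<Sum>i<4. p i * (u i * cnj (v i))) = x" "(\<Sum>i<4. p i * (u i * cnj (w i))) = y"
    "(\<Sum>i<4. p i * (v i * cnj (w i))) = z"
proof -
  have abc: "0 \<le> a" "0 \<le> b" "0 \<le> c"
    using form[of 1 0 0] form[of 0 1 0] form[of 0 0 1] by simp_all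
  have mx: "(cmod x)\<^sup>2 \<le> a * b"
    by (rule psd_form_minor) (use form[of _ "of_real _" 0] in \<open>simp add: algebra_simps\<close>)
  have my: "(cmod y)\<^sup>2 \<le> a * c"
    by (rule psd_form_minor) (use form[of _ 0 "of_real _"] in \<open>simp add: algebra_simps\<close>)
  have mz: "(cmod z)\<^sup>2 \<le> b * c"
    by (rule psd_form_minor) (use form[of 0 _ "of_real _"] in \<open>simp add: algebra_simps\<close>)
  define A B C where "A = sqrt a" and "B = sqrt b" and "C = sqrt c"
  \<comment> \<open>If a diagonal entry vanishes, so do the entries in its row, and the quotients below are 0.\<close>
  define X Y Z where "X = x / of_real (A * B)" and "Y = y / of_real (A * C)" and "Z = z / of_real (B * C)"
  have xyz: "x = of_real (A * B) * X" "y = of_real (A * C) * Y" "z = of_real (B * C) * Z"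
    using mx my mz by (auto simp: X_def Y_def Z_def A_def B_def C_def)
  \<comment> \<open>Only an inequality, because for \<open>s = 0\<close> the left side is 0. It
    suffices for \<open>N\<close>, whose diagonal coefficients are 1 even where the original
    diagonal vanishes.\<close>
  have unit: "s * (cmod (\<xi> / of_real (sqrt s)))\<^sup>2 \<le> (cmod \<xi>)\<^sup>2" if "0 \<le> s" for s :: real and \<xi> :: complex
    using that by (cases "s = 0") (simp_all add: norm_divide power_divide)
  have N: "0 \<le> (cmod \<alpha>)\<^sup>2 + (cmod \<beta>)\<^sup>2 + (cmod \<gamma>)\<^sup>2
      + 2 * Re (X * \<beta> * cnj \<alpha>) + 2 * Re (Y * \<gamma> * cnj \<alpha>) + 2 * Re (Z * \<gamma> * cnj \<beta>)" for \<alpha> \<beta> \<gamma>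
  proof -
    have "x * (\<beta> / of_real B) * cnj (\<alpha> / of_real A) = X * \<beta> * cnj \<alpha>"
      "y * (\<gamma> / of_real C) * cnj (\<alpha> / of_real A) = Y * \<gamma> * cnj \<alpha>"
      "z * (\<gamma> / of_real C) * cnj (\<beta> / of_real B) = Z * \<gamma> * cnj \<beta>"
      by (simp_all add: X_def Y_def Z_def mult_ac)
    then show ?thesis
      using form[of "\<alpha> / of_real A" "\<beta> / of_real B" "\<gamma> / of_real C"]
        unit[OF abc(1), of \<alpha>] unit[OF abc(2), of \<beta>] unit[OF abc(3), of \<gamma>]
      by (simp only: A_def B_def C_def)
  qed
  have X1: "(cmod X)\<^sup>2 \<le> 1 * 1"
    by (rule psd_form_minor) (use N[of _ "of_real _" 0] in \<open>simp add: algebra_simps\<close>)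
  have Y1: "(cmod Y)\<^sup>2 \<le> 1 * 1"
    by (rule psd_form_minor) (use N[of _ 0 "of_real _"] in \<open>simp add: algebra_simps\<close>)
  \<comment> \<open>The Schur complement of the first diagonal entry.\<close>
  have Z1: "(cmod (Z - cnj X * Y))\<^sup>2 \<le> (1 - (cmod X)\<^sup>2) * (1 - (cmod Y)\<^sup>2)"
  proof (rule psd_form_minor)
    fix \<beta> :: complex and t :: real
    have "(cmod (- (X * \<beta> + Y * of_real t)))\<^sup>2 + (cmod \<beta>)\<^sup>2 + (cmod (of_real t))\<^sup>2
      + 2 * Re (X * \<beta> * cnj (- (X * \<beta> + Y * of_real t)))
      + 2 * Re (Y * of_real t * cnj (- (X * \<beta> + Y * of_real t))) + 2 * Re (Z * of_real t * cnj \<beta>)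
      = (1 - (cmod X)\<^sup>2) * (cmod \<beta>)\<^sup>2 + (1 - (cmod Y)\<^sup>2) * t\<^sup>2 + 2 * t * Re ((Z - cnj X * Y) * cnj \<beta>)"
      unfolding cmod_power2 by (simp add: power2_eq_square algebra_simps)
    then show "0 \<le> (1 - (cmod X)\<^sup>2) * (cmod \<beta>)\<^sup>2 + (1 - (cmod Y)\<^sup>2) * t\<^sup>2 + 2 * t * Re ((Z - cnj X * Y) * cnj \<beta>)"
      using N[of "- (X * \<beta> + Y * of_real t)" \<beta> "of_real t"] by simp
  qed
  have XY1: "cmod X \<le> 1" "cmod Y \<le> 1"
    using X1 Y1 by (simp_all add: power_le_one_iff abs_square_le_1)
  obtain p :: "nat \<Rightarrow> real" and u v :: "nat \<Rightarrow> complex" where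
    p: "\<And>i. i < 4 \<Longrightarrow> 0 \<le> p i \<and> cmod (u i) = 1 \<and> cmod (v i) = 1" "(\<Sum>i<4. p i) = 1"
    and uv: "(\<Sum>i<4. p i * cnj (u i)) = X" "(\<Sum>i<4. p i * cnj (v i)) = Y"
    "(\<Sum>i<4. p i * (u i * cnj (v i))) = Z"
    using phase_mixture[OF XY1 Z1] by blast
  show thesis
  proof (rule that[of p "\<lambda>i. of_real A" "\<lambda>i. of_real B * u i" "\<lambda>i. of_real C * v i"])
    fix i :: nat assume "i < 4"
    then show "0 \<le> p i \<and> (cmod (of_real A))\<^sup>2 = a \<and> (cmod (of_real B * u i))\<^sup>2 = b
        \<and> (cmod (of_real C * v i))\<^sup>2 = c"
      using p(1) abc by (simp add: norm_mult A_def B_def C_def)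
  next
    show "(\<Sum>i<4. complex_of_real (p i) * (complex_of_real A * cnj (of_real B * u i))) = x"
      unfolding xyz uv(1)[symmetric] by (simp add: sum_distrib_left mult_ac)
    show "(\<Sum>i<4. complex_of_real (p i) * (complex_of_real A * cnj (of_real C * v i))) = y"
      unfolding xyz uv(2)[symmetric] by (simp add: sum_distrib_left mult_ac)
    show "(\<Sum>i<4. complex_of_real (p i) * (complex_of_real B * u i * cnj (of_real C * v i))) = z"
      unfolding xyz uv(3)[symmetric] by (simp add: sum_distrib_left mult_ac)
  qed (rule p(2))
qed

section \<open>Flat decompositions and their tensor products\<close>

lemma pure_decomp_iff:
  assumes "\<tau> \<in> carrier_mat n n"
  shows "pure_decomp \<tau> k p \<psi> \<longleftrightarrow>
     (\<forall>i<k. 0 \<le> p i) \<and> (\<Sum>i<k. p i) = 1 \<and> (\<forall>i<k. \<psi> i \<in> unit_vecs n) \<and>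
     (\<forall>a<n. \<forall>b<n. \<tau> $$ (a, b) = (\<Sum>i<k. of_real (p i) * (\<psi> i $ a * cnj (\<psi> i $ b))))"
proof -
  have "mat_sum n n (\<lambda>i. complex_of_real (p i) \<cdot>\<^sub>m ketbra (\<psi> i)) {..<k} $$ (a, b)
      = (\<Sum>i<k. of_real (p i) * (\<psi> i $ a * cnj (\<psi> i $ b)))"
    if "\<forall>i<k. \<psi> i \<in> unit_vecs n" "a < n" "b < n" for a b
    using that by (simp add: mat_sum_def) (auto simp: unit_vecs_iff ketbra_def intro!: sum.cong)
  then show ?thesis
    using assms unfolding pure_decomp_def
    by (auto simp: mat_eq_iff) (auto simp: mat_sum_def)
qed

definition flat_decomposable :: "nat \<Rightarrow> complex mat \<Rightarrow> bool" where
  "flat_decomposable n \<tau> \<longleftrightarrow> \<tau> \<in> carrier_mat n n \<and>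
     (\<exists>k p \<psi>. pure_decomp \<tau> k p \<psi> \<and> (\<forall>i<k. \<forall>j<n. (cmod (\<psi> i $ j))\<^sup>2 = Re (\<tau> $$ (j, j))))"

lemma flat_decomposable_diagonal:
  assumes "flat_decomposable n \<tau>" "j < n"
  shows "Im (\<tau> $$ (j, j)) = 0" "0 \<le> Re (\<tau> $$ (j, j))"
proof -
  obtain k p \<psi> where \<tau>: "\<tau> \<in> carrier_mat n n" and dec: "pure_decomp \<tau> k p \<psi>"
    using assms(1) by (auto simp: flat_decomposable_def)
  then have "\<tau> $$ (j, j) = complex_of_real (\<Sum>i<k. p i * (cmod (\<psi> i $ j))\<^sup>2)" and "\<forall>i<k. 0 \<le> p i"
    using assms(2) by (simp_all add: pure_decomp_iff[OF \<tau>] flip: complex_norm_square)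
  then show "Im (\<tau> $$ (j, j)) = 0" "0 \<le> Re (\<tau> $$ (j, j))"
    by (auto intro!: sum_nonneg)
qed

text \<open>The members are tensor products of the given members with product weights: squared
  moduli multiply entrywise, exactly as the diagonals do.\<close>

lemma flat_decomposable_kron:
  assumes "flat_decomposable n \<sigma>" "flat_decomposable m \<tau>"
  shows "flat_decomposable (n * m) (kron_mat \<sigma> \<tau>)"
proof -
  obtain k p \<phi> where \<sigma>: "\<sigma> \<in> carrier_mat n n" and 1: "pure_decomp \<sigma> k p \<phi>"
    and flat1: "\<And>i j. i < k \<Longrightarrow> j < n \<Longrightarrow> (cmod (\<phi> i $ j))\<^sup>2 = Re (\<sigma> $$ (j, j))"
    using assms(1) by (auto simp: flat_decomposable_def)
  obtain l q \<psi> where \<tau>: "\<tau> \<in> carrier_mat m m" and 2: "pure_decomp \<tau> l q \<psi>"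
    and flat2: "\<And>i j. i < l \<Longrightarrow> j < m \<Longrightarrow> (cmod (\<psi> i $ j))\<^sup>2 = Re (\<tau> $$ (j, j))"
    using assms(2) by (auto simp: flat_decomposable_def)
  have c: "kron_mat \<sigma> \<tau> \<in> carrier_mat (n * m) (n * m)"
    using \<sigma> \<tau> by (simp add: kron_mat_def)
  define r where "r i = p (i div l) * q (i mod l)" for i
  define \<chi> where "\<chi> i = vec (n * m) (\<lambda>j. \<phi> (i div l) $ (j div m) * \<psi> (i mod l) $ (j mod m))" for i
  have dm: "a div m < n" "a mod m < m" if "a < n * m" for a n m :: nat
    using that by (auto simp: less_mult_imp_div_less) (metis mod_less_divisor mult_0_right neq0_conv not_less0)
  have flat: "(cmod (\<chi> i $ j))\<^sup>2 = Re (kron_mat \<sigma> \<tau> $$ (j, j))" if "i < k * l" "j < n * m" for i j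
    using that dm[OF that(1)] dm[OF that(2)] \<sigma> \<tau> flat_decomposable_diagonal[OF assms(1), of "j div m"]
    by (simp add: \<chi>_def kron_mat_def norm_mult power_mult_distrib flat1 flat2)
  have "pure_decomp (kron_mat \<sigma> \<tau>) (k * l) r \<chi>"
    unfolding pure_decomp_iff[OF c]
  proof (intro conjI allI impI)
    fix i assume "i < k * l"
    then show "0 \<le> r i"
      using dm[of i k l] 1 2 by (simp add: r_def pure_decomp_def)
  next
    show "(\<Sum>i<k * l. r i) = 1"
      using 1 2 by (simp add: sum_lessThan_mult r_def pure_decomp_def flip: sum_distrib_left)
  next
    fix i assume i: "i < k * l"
    then have "\<phi> (i div l) \<in> unit_vecs n" "\<psi> (i mod l) \<in> unit_vecs m"
      using dm[of i k l] 1 2 \<sigma> \<tau> by (simp_all add: pure_decomp_def)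
    then show "\<chi> i \<in> unit_vecs (n * m)"
      by (simp add: unit_vecs_iff \<chi>_def sum_lessThan_mult mult_add_less norm_mult power_mult_distrib
          flip: sum_distrib_left)
  next
    fix a b assume ab: "a < n * m" "b < n * m"
    have "kron_mat \<sigma> \<tau> $$ (a, b) = \<sigma> $$ (a div m, b div m) * \<tau> $$ (a mod m, b mod m)"
      using ab \<sigma> \<tau> by (simp add: kron_mat_def)
    also have "\<dots> = (\<Sum>i<k. \<Sum>j<l. (of_real (p i) * (\<phi> i $ (a div m) * cnj (\<phi> i $ (b div m)))) *
        (of_real (q j) * (\<psi> j $ (a mod m) * cnj (\<psi> j $ (b mod m)))))"
      using 1 2 dm ab unfolding pure_decomp_iff[OF \<sigma>] pure_decomp_iff[OF \<tau>] by (simp add: sum_product)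
    also have "\<dots> = (\<Sum>i<k * l. of_real (r i) * (\<chi> i $ a * cnj (\<chi> i $ b)))"
      using ab by (simp add: sum_lessThan_mult r_def \<chi>_def mult_ac)
    finally show "kron_mat \<sigma> \<tau> $$ (a, b) = (\<Sum>i<k * l. of_real (r i) * (\<chi> i $ a * cnj (\<chi> i $ b)))" .
  qed
  then show ?thesis using c flat unfolding flat_decomposable_def by blast
qed

lemma psd_mat_form:
  assumes "psd_mat n A"
  shows "0 \<le> (\<Sum>a<n. \<Sum>b<n. A $$ (a, b) * f b * cnj (f a))"
proof -
  have "0 \<le> (A *\<^sub>v vec n f) \<bullet>c vec n f" using assms by (simp add: psd_mat_def)
  also have "\<dots> = (\<Sum>a<n. \<Sum>b<n. A $$ (a, b) * vec n f $ b * cnj (vec n f $ a))"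
    using assms by (intro quadratic_form) (auto simp: psd_mat_def)
  finally show ?thesis by simp
qed

lemma flat_decomposable_density:
  assumes "d \<le> 3" "density_mat d \<rho>"
  shows "flat_decomposable d \<rho>"
proof -
  have \<rho>: "\<rho> \<in> carrier_mat d d" and psd: "psd_mat d \<rho>" and tr: "mat_trace \<rho> = 1"
    using assms(2) by (auto simp: density_mat_def psd_mat_def)
  \<comment> \<open>Padding with zeros lets the construction for size 3 cover all smaller
    sizes.\<close>
  define M where "M a b = (if a < d \<and> b < d then \<rho> $$ (a, b) else 0)" for a b
  have 3: "{..<3} = {0, 1, 2::nat}" by auto
  have form: "0 \<le> (\<Sum>a<3. \<Sum>b<3. M a b * f b * cnj (f a))" for f
  proof -
    have "(\<Sum>b<3. M a b * f b * cnj (f a)) = (\<Sum>b<d. M a b * f b * cnj (f a))" for a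
      using assms(1) by (intro sum.mono_neutral_right) (auto simp: M_def)
    moreover have "(\<Sum>a<3. \<Sum>b<d. M a b * f b * cnj (f a)) = (\<Sum>a<d. \<Sum>b<d. M a b * f b * cnj (f a))"
      using assms(1) by (intro sum.mono_neutral_right) (auto simp: M_def)
    ultimately show ?thesis using psd_mat_form[OF psd, of f] by (simp add: M_def)
  qed
  define F where "F \<alpha> \<beta> \<gamma> = M 0 0 * \<alpha> * cnj \<alpha> + M 0 1 * \<beta> * cnj \<alpha> + M 0 2 * \<gamma> * cnj \<alpha>
     + M 1 0 * \<alpha> * cnj \<beta> + M 1 1 * \<beta> * cnj \<beta> + M 1 2 * \<gamma> * cnj \<beta>
     + M 2 0 * \<alpha> * cnj \<gamma> + M 2 1 * \<beta> * cnj \<gamma> + M 2 2 * \<gamma> * cnj \<gamma>" for \<alpha> \<beta> \<gamma>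
  have F: "0 \<le> F \<alpha> \<beta> \<gamma>" for \<alpha> \<beta> \<gamma>
    using form[of "\<lambda>i. [\<alpha>, \<beta>, \<gamma>] ! i"] by (simp add: 3 F_def add_ac)
  have Im0: "Im (F \<alpha> \<beta> \<gamma>) = 0" and Re0: "0 \<le> Re (F \<alpha> \<beta> \<gamma>)" for \<alpha> \<beta> \<gamma>
    using F[of \<alpha> \<beta> \<gamma>] by (auto simp: less_eq_complex_def)
  have diag: "Im (M 0 0) = 0" "Im (M 1 1) = 0" "Im (M 2 2) = 0"
    using Im0[of 1 0 0] Im0[of 0 1 0] Im0[of 0 0 1] by (simp_all add: F_def)
  \<comment> \<open>\<open>psd_mat\<close> does not postulate Hermiticity; it follows by
    polarization, as the form is real on vectors with entries 1 and \<open>\<i>\<close>.\<close>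
  have herm: "M 1 0 = cnj (M 0 1)" "M 2 0 = cnj (M 0 2)" "M 2 1 = cnj (M 1 2)"
    using Im0[of 1 1 0] Im0[of 1 \<i> 0] Im0[of 1 0 1] Im0[of 1 0 \<i>] Im0[of 0 1 1] Im0[of 0 1 \<i>] diag
    by (auto simp: F_def complex_eq_iff)
  have form3: "0 \<le> Re (M 0 0) * (cmod \<alpha>)\<^sup>2 + Re (M 1 1) * (cmod \<beta>)\<^sup>2 + Re (M 2 2) * (cmod \<gamma>)\<^sup>2
      + 2 * Re (M 0 1 * \<beta> * cnj \<alpha>) + 2 * Re (M 0 2 * \<gamma> * cnj \<alpha>) + 2 * Re (M 1 2 * \<gamma> * cnj \<beta>)" for \<alpha> \<beta> \<gamma>
    using Re0[of \<alpha> \<beta> \<gamma>] diag unfolding F_def herm cmod_power2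
    by (simp add: algebra_simps power2_eq_square)
  obtain p :: "nat \<Rightarrow> real" and u v w :: "nat \<Rightarrow> complex" where
    p: "\<And>i. i < 4 \<Longrightarrow> 0 \<le> p i \<and> (cmod (u i))\<^sup>2 = Re (M 0 0) \<and> (cmod (v i))\<^sup>2 = Re (M 1 1)
          \<and> (cmod (w i))\<^sup>2 = Re (M 2 2)" "(\<Sum>i<4. p i) = 1"
    and off: "(\<Sum>i<4. p i * (u i * cnj (v i))) = M 0 1" "(\<Sum>i<4. p i * (u i * cnj (w i))) = M 0 2"
    "(\<Sum>i<4. p i * (v i * cnj (w i))) = M 1 2"
    using hermitian_form_mixture[OF form3] by blast
  define e where "e i a = [u i, v i, w i] ! a" for i and a :: nat
  define \<psi> where "\<psi> i = vec d (e i)" for i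
  have flat: "(cmod (e i a))\<^sup>2 = Re (M a a)" if "i < 4" "a < 3" for i a
  proof -
    from that have "a \<in> {0, 1, 2}" by auto
    then show ?thesis using p(1)[OF that(1)] by (auto simp: e_def)
  qed
  have M_mix: "M a b = (\<Sum>i<4. of_real (p i) * (e i a * cnj (e i b)))" if "a < 3" "b < 3" for a b
  proof -
    have dg: "M a a = (\<Sum>i<4. of_real (p i) * (e i a * cnj (e i a)))" if "a < 3" for a
    proof -
      have "(\<Sum>i<4. of_real (p i) * (e i a * cnj (e i a))) = (\<Sum>i<4. complex_of_real (p i * Re (M a a)))"
        using flat that by (simp add: complex_norm_square[symmetric])
      also have "\<dots> = of_real (Re (M a a))"
        using p(2) by (simp flip: of_real_sum of_real_mult sum_distrib_right)
      also have "a \<in> {0, 1, 2}" using that by auto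
      then have "of_real (Re (M a a)) = M a a" using diag by (auto simp: complex_eq_iff)
      finally show ?thesis by simp
    qed
    have sym: "cnj (\<Sum>i<4. of_real (p i) * (f i * cnj (g i))) = (\<Sum>i<4. of_real (p i) * (g i * cnj (f i)))" for f g
      by (simp add: mult_ac)
    have "a \<in> {0, 1, 2}" "b \<in> {0, 1, 2}" using that by auto
    then show ?thesis
      using dg[OF that(1)] off herm sym[of u v] sym[of u w] sym[of v w]
      by (auto simp: e_def)
  qed
  have Mr: "\<rho> $$ (a, b) = M a b" if "a < d" "b < d" for a b
    using that by (simp add: M_def)
  have "pure_decomp \<rho> 4 p \<psi>"
    unfolding pure_decomp_iff[OF \<rho>]
  proof (intro conjI allI impI)
    fix i :: nat assume i: "i < 4"
    then show "0 \<le> p i" using p(1) by blast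
    have "(\<Sum>j<d. Re (M j j)) = Re (mat_trace \<rho>)"
      by (simp add: mat_trace_eq[OF \<rho>] Mr)
    then show "\<psi> i \<in> unit_vecs d"
      using i assms(1) tr flat by (simp add: unit_vecs_iff \<psi>_def)
  next
    fix a b assume ab: "a < d" "b < d"
    then show "\<rho> $$ (a, b) = (\<Sum>i<4. of_real (p i) * (\<psi> i $ a * cnj (\<psi> i $ b)))"
      using assms(1) by (simp add: Mr M_mix \<psi>_def)
  qed (rule p(2))
  moreover have "(cmod (\<psi> i $ j))\<^sup>2 = Re (\<rho> $$ (j, j))" if "i < 4" "j < d" for i j
    using that assms(1) flat by (simp add: Mr \<psi>_def)
  ultimately show ?thesis using \<rho> unfolding flat_decomposable_def by blast
qed

section \<open>The upper bound for MIO\<close>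

text \<open>The real part of the expectation of \<open>Y\<close> in the maximally coherent state,
  whose amplitudes are all \<open>1 / sqrt m\<close>.\<close>

definition coherent_overlap :: "nat \<Rightarrow> complex mat \<Rightarrow> real" where
  "coherent_overlap m Y = (\<Sum>a<m. \<Sum>b<m. Re (Y $$ (a, b))) / real m"

lemma hs_inner_max_coherent:
  assumes "Y \<in> carrier_mat m m"
  shows "Re (hs_inner Y (ketbra (max_coherent_vec m))) = coherent_overlap m Y"
proof -
  let ?K = "ketbra (max_coherent_vec m)"
  have K: "?K \<in> carrier_mat m m" by simp
  have "hs_inner Y ?K = (\<Sum>b<m. \<Sum>a<m. mat_adjoint Y $$ (b, a) * ?K $$ (a, b))"
    using carrier_matD[OF mat_adjoint_carrier[OF assms]] carrier_matD[OF K]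
    by (simp add: hs_inner_def mat_trace_def scalar_prod_def lessThan_atLeast0)
  also have "\<dots> = (\<Sum>b<m. \<Sum>a<m. cnj (Y $$ (a, b)) / of_nat m)"
    by (simp add: mat_adjoint_entry[OF assms] ketbra_max_coherent_entry)
  also have "Re \<dots> = (\<Sum>b<m. \<Sum>a<m. Re (Y $$ (a, b)) / real m)"
    by (simp add: Re_divide_of_nat)
  also have "\<dots> = coherent_overlap m Y"
    by (subst sum.swap) (simp add: coherent_overlap_def sum_divide_distrib)
  finally show ?thesis .
qed

lemma coherent_overlap_nonneg:
  assumes "psd_mat m Y"
  shows "0 \<le> coherent_overlap m Y"
  using psd_mat_form[OF assms, of "\<lambda>_. 1"]
  by (simp add: coherent_overlap_def less_eq_complex_def)

text \<open>Positivity on the difference of two basis vectors bounds a pair of mirrored entries by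
  the two diagonal ones; summing over all pairs gives the claim without a spectral
  decomposition.\<close>

lemma coherent_overlap_le_trace:
  assumes psd: "psd_mat m Y" and m: "1 \<le> m"
  shows "coherent_overlap m Y \<le> Re (mat_trace Y)"
proof -
  have Y: "Y \<in> carrier_mat m m" using psd by (simp add: psd_mat_def)
  have pair: "Re (Y $$ (a, b)) + Re (Y $$ (b, a)) \<le> Re (Y $$ (a, a)) + Re (Y $$ (b, b))"
    if "a < m" "b < m" for a b
  proof -
    let ?f = "\<lambda>i. (if i = a then 1 else 0) - (if i = b then 1 else 0) :: complex"
    have *: "(\<Sum>i<m. g i * ?f i) = g a - g b" for g :: "nat \<Rightarrow> complex"
    proof -
      have "(\<Sum>i<m. g i * ?f i) = (\<Sum>i<m. (if i = a then g a else 0) - (if i = b then g b else 0))"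
        by (intro sum.cong refl) auto
      then show ?thesis using that by (simp add: sum_subtractf)
    qed
    have "0 \<le> (\<Sum>i<m. (\<Sum>j<m. Y $$ (i, j) * ?f j) * ?f i)"
    proof -
      have "cnj (?f i) = ?f i" for i by simp
      then show ?thesis
        using psd_mat_form[OF psd, of ?f] by (simp only: sum_distrib_right)
    qed
    also have "\<dots> = (Y $$ (a, a) - Y $$ (a, b)) - (Y $$ (b, a) - Y $$ (b, b))"
      by (simp only: *)
    finally show ?thesis by (simp add: less_eq_complex_def)
  qed
  have "2 * (\<Sum>a<m. \<Sum>b<m. Re (Y $$ (a, b))) = (\<Sum>a<m. \<Sum>b<m. Re (Y $$ (a, b)) + Re (Y $$ (b, a)))"
    by (simp add: sum.distrib) (rule sum.swap)
  also have "\<dots> \<le> (\<Sum>a<m. \<Sum>b<m. Re (Y $$ (a, a)) + Re (Y $$ (b, b)))"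
    by (intro sum_mono pair) auto
  also have "\<dots> = 2 * real m * Re (mat_trace Y)"
    by (simp add: sum.distrib mat_trace_eq[OF Y] sum_distrib_left mult.assoc)
  finally show ?thesis using m by (simp add: coherent_overlap_def field_simps)
qed

lemma coherent_overlap_incoherent:
  assumes "incoherent_state m Y"
  shows "coherent_overlap m Y = 1 / real m"
proof -
  have Y: "Y \<in> carrier_mat m m" and deph: "dephase Y = Y" and tr: "mat_trace Y = 1"
    using assms by (auto simp: incoherent_state_def density_mat_def psd_mat_def)
  have "(\<Sum>b<m. Re (Y $$ (a, b))) = Re (Y $$ (a, a))" if "a < m" for a
  proof -
    have "(\<Sum>b<m. Re (dephase Y $$ (a, b))) = (\<Sum>b<m. if b = a then Re (Y $$ (a, a)) else 0)"
      using Y that by (intro sum.cong refl) (auto simp: dephase_def)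
    then show ?thesis using that by (simp add: deph)
  qed
  then have "(\<Sum>a<m. \<Sum>b<m. Re (Y $$ (a, b))) = Re (mat_trace Y)"
    by (simp add: mat_trace_eq[OF Y])
  then show ?thesis by (simp add: coherent_overlap_def tr)
qed

lemma coherent_overlap_linear:
  assumes "channel n m E" "X \<in> carrier_mat n n" "Y \<in> carrier_mat n n" "Z \<in> carrier_mat n n"
  shows "coherent_overlap m (E (of_real x \<cdot>\<^sub>m X + of_real y \<cdot>\<^sub>m Y + of_real z \<cdot>\<^sub>m Z))
    = x * coherent_overlap m (E X) + y * coherent_overlap m (E Y) + z * coherent_overlap m (E Z)"
proof -
  have c: "E X \<in> carrier_mat m m" "E Y \<in> carrier_mat m m" "E Z \<in> carrier_mat m m"
    using assms by (simp_all add: channel_def)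
  have "E (of_real x \<cdot>\<^sub>m X + of_real y \<cdot>\<^sub>m Y + of_real z \<cdot>\<^sub>m Z)
      = of_real x \<cdot>\<^sub>m E X + of_real y \<cdot>\<^sub>m E Y + of_real z \<cdot>\<^sub>m E Z"
    using assms by (simp add: channel_def)
  then show ?thesis
    using c by (simp add: coherent_overlap_def sum.distrib add_divide_distrib flip: sum_distrib_left)
qed

text \<open>These are the bounds \<open>0 \<le> W \<le> 1\<close> for the dual effect, obtained
  without constructing \<open>W\<close>.\<close>

lemma coherent_overlap_channel:
  assumes "channel n m E" "1 \<le> m" "psd_mat n X"
  shows "0 \<le> coherent_overlap m (E X)" "coherent_overlap m (E X) \<le> Re (mat_trace X)"
proof -
  have psd: "psd_mat m (E X)" using assms channel_psd by blast
  then show "0 \<le> coherent_overlap m (E X)" by (rule coherent_overlap_nonneg)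
  have "mat_trace (E X) = mat_trace X"
    using assms(1,3) by (simp add: channel_def psd_mat_def)
  then show "coherent_overlap m (E X) \<le> Re (mat_trace X)"
    using coherent_overlap_le_trace[OF psd assms(2)] by simp
qed

text \<open>For an incoherent pure state \<open>e\<close>, an operation in MIO gives overlap \<open>1 / m\<close>. The overlap and its
  complement to the trace are positive forms, so Cauchy--Schwarz for both of them, here in the
  form of a discriminant argument, bounds \<open>\<langle>e, \<psi>\<rangle>\<close>.\<close>

lemma MIO_amplitude_bound:
  assumes E: "E \<in> MIO n m" and m: "1 \<le> m" and \<psi>: "\<psi> \<in> unit_vecs n" and j: "j < n" and c: "0 < c"
  shows "(1 - c) * (cmod (\<psi> $ j))\<^sup>2 \<le> 1 / real m + (1 - coherent_overlap m (E (ketbra \<psi>))) / c"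
proof -
  have ch: "channel n m E" using E by (simp add: MIO_def)
  have \<psi>c: "\<psi> \<in> carrier_vec n" and \<psi>1: "(\<Sum>i<n. (cmod (\<psi> $ i))\<^sup>2) = 1"
    using \<psi> by (auto simp: unit_vecs_iff)
  define A where "A = (cmod (\<psi> $ j))\<^sup>2"
  define e where "e = (unit_vec n j :: complex vec)"
  have ec: "e \<in> carrier_vec n" by (simp add: e_def)
  have e1: "(\<Sum>i<n. (cmod (e $ i))\<^sup>2) = 1"
  proof -
    have "(\<Sum>i<n. (cmod (e $ i))\<^sup>2) = (\<Sum>i<n. if i = j then 1 else 0)"
      using j by (intro sum.cong refl) (auto simp: e_def)
    then show ?thesis using j by simp
  qed
  \<comment> \<open>The cross terms of the projector onto \<open>w x y\<close> below. Scaling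
    \<open>e\<close> by \<open>\<psi> $ j\<close> aligns its phase with \<psi>, so real coefficients
    suffice and the trace of \<open>H\<close> is the real number \<open>2 * A\<close>.\<close>
  define H where "H = mat n n (\<lambda>(i, k). \<psi> $ i * cnj (\<psi> $ j * e $ k) + \<psi> $ j * e $ i * cnj (\<psi> $ k))"
  have Hc: "H \<in> carrier_mat n n" by (simp add: H_def)
  have "mat_trace (ketbra e) = 1"
    by (simp only: mat_trace_ketbra[OF ec] e1 of_real_1)
  moreover have "dephase (ketbra e) = ketbra e"
    by (intro eq_matI) (auto simp: dephase_def ketbra_def e_def unit_vec_def)
  ultimately have inc: "incoherent_state n (ketbra e)"
    using psd_mat_ketbra[OF ec] by (simp add: incoherent_state_def density_mat_def)
  then have ov_e: "coherent_overlap m (E (ketbra e)) = 1 / real m"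
    using E coherent_overlap_incoherent by (simp add: MIO_def)
  define w where "w x y = of_real x \<cdot>\<^sub>v \<psi> + of_real y \<cdot>\<^sub>v (\<psi> $ j \<cdot>\<^sub>v e)" for x y
  have wc: "w x y \<in> carrier_vec n" for x y using \<psi>c ec by (simp add: w_def)
  have A_mult: "\<psi> $ j * cnj (\<psi> $ j) = of_real A"
    by (simp add: A_def complex_norm_square del: of_real_power)
  have ket: "ketbra (w x y) = of_real (x\<^sup>2) \<cdot>\<^sub>m ketbra \<psi> + of_real (y\<^sup>2 * A) \<cdot>\<^sub>m ketbra e + of_real (x * y) \<cdot>\<^sub>m H" for x y
  proof (rule eq_matI)
    fix i k assume "i < dim_row (of_real (x\<^sup>2) \<cdot>\<^sub>m ketbra \<psi> + of_real (y\<^sup>2 * A) \<cdot>\<^sub>m ketbra e + of_real (x * y) \<cdot>\<^sub>m H)"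
      "k < dim_col (of_real (x\<^sup>2) \<cdot>\<^sub>m ketbra \<psi> + of_real (y\<^sup>2 * A) \<cdot>\<^sub>m ketbra e + of_real (x * y) \<cdot>\<^sub>m H)"
    then have ik: "i < n" "k < n" by (auto simp: H_def)
    then show "ketbra (w x y) $$ (i, k)
        = (of_real (x\<^sup>2) \<cdot>\<^sub>m ketbra \<psi> + of_real (y\<^sup>2 * A) \<cdot>\<^sub>m ketbra e + of_real (x * y) \<cdot>\<^sub>m H) $$ (i, k)"
      using \<psi>c ec carrier_matD[OF Hc] carrier_matD[OF ketbra_carrier[OF \<psi>c]] carrier_matD[OF ketbra_carrier[OF ec]]
      by (simp add: ketbra_entry[OF wc] ketbra_entry[OF \<psi>c] ketbra_entry[OF ec] A_mult[symmetric])
        (simp add: w_def H_def algebra_simps power2_eq_square)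
  qed (use carrier_matD[OF Hc] carrier_matD[OF ketbra_carrier[OF wc]] in auto)
  define g G where "g = coherent_overlap m (E (ketbra \<psi>))" and "G = coherent_overlap m (E H)"
  have ov: "coherent_overlap m (E (ketbra (w x y))) = x\<^sup>2 * g + y\<^sup>2 * A / real m + x * y * G" for x y
    unfolding ket coherent_overlap_linear[OF ch ketbra_carrier[OF \<psi>c] ketbra_carrier[OF ec] Hc]
    by (simp add: g_def G_def ov_e)
  have trH: "mat_trace H = of_real (2 * A)"
  proof -
    have "mat_trace H = (\<Sum>i<n. if i = j then of_real (2 * A) else 0)"
      unfolding mat_trace_eq[OF Hc] using j A_mult by (intro sum.cong refl) (auto simp: H_def e_def mult_ac)
    then show ?thesis using j by simp
  qed
  have tr: "Re (mat_trace (ketbra (w x y))) = x\<^sup>2 + y\<^sup>2 * A + x * y * (2 * A)" for x y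
  proof -
    have "mat_trace (ketbra (w x y)) = of_real (x\<^sup>2) * mat_trace (ketbra \<psi>)
        + of_real (y\<^sup>2 * A) * mat_trace (ketbra e) + of_real (x * y) * mat_trace H"
      unfolding ket using Hc \<psi>c ec carrier_matD[OF Hc] carrier_matD[OF ketbra_carrier[OF \<psi>c]] carrier_matD[OF ketbra_carrier[OF ec]]
      by (simp add: mat_trace_def sum.distrib sum_distrib_left)
    then show ?thesis
      unfolding mat_trace_ketbra[OF \<psi>c] mat_trace_ketbra[OF ec] \<psi>1 e1 trH
      by (simp flip: of_real_mult of_real_add of_real_power)
  qed
  note bounds = coherent_overlap_channel[OF ch m psd_mat_ketbra[OF wc]]
  have lower: "0 \<le> x\<^sup>2 * g + y\<^sup>2 * A / real m + x * y * G" for x y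
    using bounds(1)[of x y] by (simp only: ov)
  have upper: "x\<^sup>2 * g + y\<^sup>2 * A / real m + x * y * G \<le> x\<^sup>2 + y\<^sup>2 * A + x * y * (2 * A)" for x y
    using bounds(2)[of x y] by (simp only: ov tr)
  \<comment> \<open>\<open>lower\<close> at \<open>(1, - m)\<close> gives
    \<open>m * G \<le> g + m * A\<close>. The product \<open>x * y = m\<close> produces the same
    \<open>m * G\<close> in \<open>upper\<close> at \<open>(x, - y)\<close>, so \<open>G\<close>
    cancels; the ratio \<open>x / y = 1 / c\<close> balances the defect \<open>1 - g\<close> against
    \<open>A\<close>.\<close>
  define x y where "x = sqrt (real m / c)" and "y = sqrt (real m * c)"
  have x2: "x\<^sup>2 = real m / c" and y2: "y\<^sup>2 = real m * c"
    using c by (simp_all add: x_def y_def)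
  have "x * y = sqrt (real m * real m)"
    using c by (simp add: x_def y_def flip: real_sqrt_mult)
  then have xy: "x * y = real m" by simp
  have A0: "0 \<le> A" by (simp add: A_def)
  have "real m * A * 2 \<le> g + real m * A + real m / c * (1 - g) + real m * c * A - c * A"
    using lower[of 1 "- real m"] upper[of x "- y"] m unfolding x2 y2 power2_minus
    by (simp add: xy power2_eq_square algebra_simps diff_divide_distrib)
  moreover have "g \<le> 1"
    using upper[of 1 0] by simp
  moreover have "0 \<le> c * A"
    using A0 c by simp
  ultimately have "real m * ((1 - c) * A) \<le> 1 + real m / c * (1 - g)"
    by (simp add: algebra_simps)
  then show ?thesis using m by (simp add: A_def g_def field_simps)
qed

section \<open>The distillation rate\<close>

lemma overlap_of_mixture:
  assumes "\<And>i. i < k \<Longrightarrow> F i \<in> carrier_mat m m"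
  shows "Re (hs_inner (mat_sum m m (\<lambda>i. complex_of_real (p i) \<cdot>\<^sub>m F i) {..<k}) (ketbra (max_coherent_vec m)))
    = (\<Sum>i<k. p i * coherent_overlap m (F i))"
proof -
  let ?Y = "mat_sum m m (\<lambda>i. complex_of_real (p i) \<cdot>\<^sub>m F i) {..<k}"
  have "Re (?Y $$ (a, b)) = (\<Sum>i<k. p i * Re (F i $$ (a, b)))" if "a < m" "b < m" for a b
  proof -
    have "?Y $$ (a, b) = (\<Sum>i<k. complex_of_real (p i) * F i $$ (a, b))"
      using that assms by (simp add: mat_sum_def) (intro sum.cong refl, fastforce)
    then show ?thesis by simp
  qed
  then have "coherent_overlap m ?Y = (\<Sum>a<m. \<Sum>b<m. \<Sum>i<k. p i * Re (F i $$ (a, b))) / real m"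
    by (simp add: coherent_overlap_def)
  also have "\<dots> = (\<Sum>i<k. \<Sum>a<m. \<Sum>b<m. p i * Re (F i $$ (a, b))) / real m"
    by (simp only: sum.swap[of _ "{..<m}" "{..<k}"])
  also have "\<dots> = (\<Sum>i<k. p i * coherent_overlap m (F i))"
    by (simp add: coherent_overlap_def sum_distrib_left sum_divide_distrib)
  finally show ?thesis
    by (subst hs_inner_max_coherent) (auto simp: mat_sum_def)
qed

definition assisted_values :: "operation_class \<Rightarrow> complex mat \<Rightarrow> nat \<Rightarrow> real set" where
  "assisted_values \<O> \<tau> m = {\<Sum>i<k. p i * coherent_overlap m (\<Lambda> i (ketbra (\<psi> i))) | k p \<psi> \<Lambda>.
     pure_decomp \<tau> k p \<psi> \<and> (\<forall>i<k. \<Lambda> i \<in> \<O> (dim_row \<tau>) m)}"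

lemma free_subset_MIO: "\<O> \<in> {MIO, DIO, IO, SIO} \<Longrightarrow> \<O> n m \<subseteq> MIO n m"
  using DIO_subset_MIO IO_subset_MIO SIO_subset_IO by blast

lemma assisted_fidelity_eq:
  assumes \<O>: "\<O> \<in> {MIO, DIO, IO, SIO}"
  shows "assisted_fidelity \<O> \<tau> m = Sup (assisted_values \<O> \<tau> m)"
proof -
  have "Re (hs_inner (mat_sum m m (\<lambda>i. complex_of_real (p i) \<cdot>\<^sub>m \<Lambda> i (ketbra (\<psi> i))) {..<k})
            (ketbra (max_coherent_vec m))) = (\<Sum>i<k. p i * coherent_overlap m (\<Lambda> i (ketbra (\<psi> i))))"
    if "pure_decomp \<tau> k p \<psi>" "\<forall>i<k. \<Lambda> i \<in> \<O> (dim_row \<tau>) m" for k p \<psi> \<Lambda>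
  proof (rule overlap_of_mixture)
    fix i assume "i < k"
    then have "channel (dim_row \<tau>) m (\<Lambda> i)" "\<psi> i \<in> carrier_vec (dim_row \<tau>)"
      using that free_subset_MIO[OF \<O>] by (auto simp: MIO_def pure_decomp_def unit_vecs_iff)
    then show "\<Lambda> i (ketbra (\<psi> i)) \<in> carrier_mat m m"
      by (simp add: channel_def)
  qed
  then show ?thesis
    unfolding assisted_fidelity_def assisted_values_def
    by (intro arg_cong[of _ _ Sup] Collect_cong) (metis (no_types, lifting))
qed

lemma assisted_values_le_1:
  assumes \<O>: "\<O> \<in> {MIO, DIO, IO, SIO}" and m: "1 \<le> m" and "x \<in> assisted_values \<O> \<tau> m"
  shows "x \<le> 1"
proof -
  obtain k p \<psi> \<Lambda> where x: "x = (\<Sum>i<k. p i * coherent_overlap m (\<Lambda> i (ketbra (\<psi> i))))"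
    and dec: "pure_decomp \<tau> k p \<psi>" and \<Lambda>: "\<forall>i<k. \<Lambda> i \<in> \<O> (dim_row \<tau>) m"
    using assms(3) by (auto simp: assisted_values_def)
  have "coherent_overlap m (\<Lambda> i (ketbra (\<psi> i))) \<le> 1" if "i < k" for i
  proof -
    have "channel (dim_row \<tau>) m (\<Lambda> i)" using \<Lambda> that free_subset_MIO[OF \<O>] by (auto simp: MIO_def)
    moreover have \<psi>: "\<psi> i \<in> carrier_vec (dim_row \<tau>)" "(\<Sum>j<dim_row \<tau>. (cmod (\<psi> i $ j))\<^sup>2) = 1"
      using dec that by (auto simp: pure_decomp_def unit_vecs_iff)
    ultimately show ?thesis
      using coherent_overlap_channel(2)[OF _ m psd_mat_ketbra[OF \<psi>(1)]]
      unfolding mat_trace_ketbra[OF \<psi>(1)] \<psi>(2) by simp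
  qed
  then have "x \<le> (\<Sum>i<k. p i * 1)"
    unfolding x using dec by (intro sum_mono mult_left_mono) (auto simp: pure_decomp_def)
  then show ?thesis using dec by (simp add: pure_decomp_def)
qed

text \<open>The bound for one pure state is affine in the overlap, so its weighted average over the
  decomposition has the same form, with \<tau>'s diagonal entry on the left.\<close>

lemma assisted_values_diagonal_bound:
  assumes \<O>: "\<O> \<in> {MIO, DIO, IO, SIO}" and m: "1 \<le> m" and \<tau>: "\<tau> \<in> carrier_mat n n"
    and x: "x \<in> assisted_values \<O> \<tau> m" and j: "j < n" and c: "0 < c"
  shows "(1 - c) * Re (\<tau> $$ (j, j)) \<le> 1 / real m + (1 - x) / c"
proof -
  obtain k p \<psi> \<Lambda> where x: "x = (\<Sum>i<k. p i * coherent_overlap m (\<Lambda> i (ketbra (\<psi> i))))"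
    and dec: "pure_decomp \<tau> k p \<psi>" and \<Lambda>: "\<forall>i<k. \<Lambda> i \<in> \<O> n m"
    using x \<tau> by (auto simp: assisted_values_def)
  have p: "\<And>i. i < k \<Longrightarrow> 0 \<le> p i" "(\<Sum>i<k. p i) = 1" "\<And>i. i < k \<Longrightarrow> \<psi> i \<in> unit_vecs n"
    and entry: "\<tau> $$ (j, j) = (\<Sum>i<k. of_real (p i) * (\<psi> i $ j * cnj (\<psi> i $ j)))"
    using dec j unfolding pure_decomp_iff[OF \<tau>] by auto
  have "\<tau> $$ (j, j) = complex_of_real (\<Sum>i<k. p i * (cmod (\<psi> i $ j))\<^sup>2)"
    unfolding entry by (simp flip: complex_norm_square)
  then have "(1 - c) * Re (\<tau> $$ (j, j)) = (\<Sum>i<k. p i * ((1 - c) * (cmod (\<psi> i $ j))\<^sup>2))"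
    by (simp add: sum_distrib_left mult_ac)
  also have "\<dots> \<le> (\<Sum>i<k. p i * (1 / real m + (1 - coherent_overlap m (\<Lambda> i (ketbra (\<psi> i)))) / c))"
  proof (intro sum_mono mult_left_mono)
    fix i assume i: "i \<in> {..<k}"
    then have "\<Lambda> i \<in> MIO n m" using \<Lambda> free_subset_MIO[OF \<O>] by blast
    then show "(1 - c) * (cmod (\<psi> i $ j))\<^sup>2 \<le> 1 / real m + (1 - coherent_overlap m (\<Lambda> i (ketbra (\<psi> i)))) / c"
      using MIO_amplitude_bound m p(3) i j c by blast
  qed (use p in auto)
  also have "\<dots> = (\<Sum>i<k. p i) * (1 / real m) + ((\<Sum>i<k. p i) - x) / c"
    by (simp add: x algebra_simps sum.distrib sum_distrib_left sum_distrib_right sum_subtractf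
        diff_divide_distrib sum_divide_distrib)
  finally show ?thesis using p(2) by simp
qed

lemma coherent_overlap_max_coherent: "1 \<le> m \<Longrightarrow> coherent_overlap m (ketbra (max_coherent_vec m)) = 1"
  by (simp add: coherent_overlap_def ketbra_max_coherent_entry Re_divide_of_nat)

text \<open>For necessity, attainable values \<open>x\<close> approach 1 at fixed \<open>c\<close>,
  which removes the defect term, and then \<open>c\<close> tends to 0. For sufficiency, flatness
  turns the condition on \<tau> into the cap for every member, so the value 1 is attained.\<close>

lemma assisted_fidelity_ge_1_iff:
  assumes \<O>: "\<O> \<in> {MIO, DIO, IO, SIO}" and m: "1 \<le> m" and flat: "flat_decomposable n \<tau>"
  shows "1 \<le> assisted_fidelity \<O> \<tau> m \<longleftrightarrow> (\<forall>j<n. real m * Re (\<tau> $$ (j, j)) \<le> 1)"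
proof -
  let ?V = "assisted_values \<O> \<tau> m"
  obtain k p \<psi> where \<tau>: "\<tau> \<in> carrier_mat n n" and dec: "pure_decomp \<tau> k p \<psi>"
    and \<psi>: "\<And>i j. i < k \<Longrightarrow> j < n \<Longrightarrow> (cmod (\<psi> i $ j))\<^sup>2 = Re (\<tau> $$ (j, j))"
    using flat by (auto simp: flat_decomposable_def)
  obtain E where "E \<in> \<O> n m" using free_reset[OF \<O> m] by blast
  then have "(\<Sum>i<k. p i * coherent_overlap m (E (ketbra (\<psi> i)))) \<in> ?V"
    unfolding assisted_values_def mem_Collect_eq using dec \<tau>
    by (intro exI[of _ k] exI[of _ p] exI[of _ \<psi>] exI[of _ "\<lambda>_. E"]) simp
  then have ne: "?V \<noteq> {}" by blast
  have bdd: "bdd_above ?V" using assisted_values_le_1[OF \<O> m] by (intro bdd_aboveI)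
  show ?thesis
    unfolding assisted_fidelity_eq[OF \<O>]
  proof
    assume sup: "1 \<le> Sup ?V"
    show "\<forall>j<n. real m * Re (\<tau> $$ (j, j)) \<le> 1"
    proof (intro allI impI)
      fix j assume j: "j < n"
      define t where "t = Re (\<tau> $$ (j, j))"
      have *: "(1 - c) * t \<le> 1 / real m" if c: "0 < c" for c
      proof (rule field_le_epsilon)
        fix \<epsilon> :: real assume \<epsilon>: "0 < \<epsilon>"
        \<comment> \<open>The defect \<open>c * \<epsilon>\<close> becomes \<open>\<epsilon>\<close>
          after the division by \<open>c\<close> in the diagonal bound.\<close>
        then have "1 - c * \<epsilon> < Sup ?V" using sup c by (smt (verit) mult_pos_pos)
        then obtain x where x: "x \<in> ?V" "1 - c * \<epsilon> < x" using less_cSupE[OF _ ne] by blast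
        have "(1 - c) * t \<le> 1 / real m + (1 - x) / c"
          unfolding t_def by (rule assisted_values_diagonal_bound[OF \<O> m \<tau> x(1) j c])
        also have "(1 - x) / c \<le> \<epsilon>" using x(2) c by (simp add: field_simps)
        finally show "(1 - c) * t \<le> 1 / real m + \<epsilon>" by simp
      qed
      have t0: "0 \<le> t" using flat_decomposable_diagonal[OF flat j] by (simp add: t_def)
      have "t \<le> 1 / real m"
      proof (rule field_le_epsilon)
        fix \<epsilon> :: real assume \<epsilon>: "0 < \<epsilon>"
        \<comment> \<open>Used in place of \<open>c\<close>: it is positive also for
          \<open>t = 0\<close>, and the loss \<open>k * t\<close> is at most
          \<open>\<epsilon>\<close>.\<close>
        define k where "k = \<epsilon> / (t + 1)"
        have "t = (1 - k) * t + k * t" by (simp add: algebra_simps)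
        also have "(1 - k) * t \<le> 1 / real m" using \<epsilon> t0 by (intro *) (simp add: k_def)
        also have "k * t \<le> \<epsilon>" using \<epsilon> t0 by (simp add: k_def field_simps)
        finally show "t \<le> 1 / real m + \<epsilon>" by simp
      qed
      then show "real m * Re (\<tau> $$ (j, j)) \<le> 1" using m by (simp add: t_def field_simps)
    qed
  next
    assume cap: "\<forall>j<n. real m * Re (\<tau> $$ (j, j)) \<le> 1"
    have "\<exists>E. E \<in> \<O> n m \<and> E (ketbra (\<psi> i)) = ketbra (max_coherent_vec m)" if "i < k" for i
      using pure_state_distillation[OF \<O> _ m, of "\<psi> i" n] \<psi>[OF that] cap dec that \<tau>
      by (auto simp: pure_decomp_def)
    then obtain \<Lambda> where \<Lambda>: "\<And>i. i < k \<Longrightarrow> \<Lambda> i \<in> \<O> n m \<and> \<Lambda> i (ketbra (\<psi> i)) = ketbra (max_coherent_vec m)"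
      by metis
    have "(\<Sum>i<k. p i * coherent_overlap m (\<Lambda> i (ketbra (\<psi> i)))) = (\<Sum>i<k. p i)"
      using \<Lambda> coherent_overlap_max_coherent[OF m] by (intro sum.cong) auto
    also have "\<dots> = 1" using dec by (simp add: pure_decomp_def)
    finally have "1 \<in> ?V"
      using dec \<Lambda> \<tau> unfolding assisted_values_def mem_Collect_eq by (metis carrier_matD(1))
    then show "1 \<le> Sup ?V" using bdd by (rule cSup_upper)
  qed
qed

section \<open>Exact rates, tensor powers and the limit\<close>

definition max_diagonal :: "nat \<Rightarrow> complex mat \<Rightarrow> real \<Rightarrow> bool" where
  "max_diagonal n \<tau> L \<longleftrightarrow> (\<exists>j<n. Re (\<tau> $$ (j, j)) = L) \<and> (\<forall>j<n. Re (\<tau> $$ (j, j)) \<le> L)"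

text \<open>The admissible \<open>m\<close> form the interval from 1 to the integer part of
  \<open>1 / L\<close>, nonempty because \<open>L \<le> 1\<close>.\<close>

lemma zero_error_assisted_rate_flat:
  assumes \<O>: "\<O> \<in> {MIO, DIO, IO, SIO}" and flat: "flat_decomposable n \<tau>"
    and max: "max_diagonal n \<tau> L" and L: "0 < L" "L \<le> 1"
  shows "zero_error_assisted_rate \<O> \<tau> = log 2 (real (nat \<lfloor>1 / L\<rfloor>))"
proof -
  have "{m::nat. 1 \<le> m \<and> 1 \<le> assisted_fidelity \<O> \<tau> m} = {m. 1 \<le> m \<and> real m * L \<le> 1}"
  proof (intro Collect_cong conj_cong refl)
    fix m :: nat assume m: "1 \<le> m"
    have "(\<forall>j<n. real m * Re (\<tau> $$ (j, j)) \<le> 1) \<longleftrightarrow> real m * L \<le> 1"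
      using max unfolding max_diagonal_def
      by (metis mult_left_mono of_nat_0_le_iff order_trans)
    then show "1 \<le> assisted_fidelity \<O> \<tau> m \<longleftrightarrow> real m * L \<le> 1"
      using assisted_fidelity_ge_1_iff[OF \<O> m flat] by simp
  qed
  also have "\<dots> = {1..nat \<lfloor>1 / L\<rfloor>}"
    using L by (auto simp: le_nat_floor field_simps) (metis mult.commute of_nat_floor le_divide_eq le_trans of_nat_le_iff zero_le_divide_1_iff less_imp_le order_trans)
  also have "Max \<dots> = nat \<lfloor>1 / L\<rfloor>"
    using L by (intro Max_eqI) (auto simp: le_nat_iff le_floor_iff)
  finally show ?thesis by (simp add: zero_error_assisted_rate_def)
qed

text \<open>Since the diagonals are nonnegative, the largest product is the product of the largest
  factors.\<close>

lemma max_diagonal_kron: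
  assumes \<sigma>: "flat_decomposable n \<sigma>" "max_diagonal n \<sigma> K" and \<tau>: "flat_decomposable m \<tau>" "max_diagonal m \<tau> L"
  shows "max_diagonal (n * m) (kron_mat \<sigma> \<tau>) (K * L)"
proof -
  have c: "\<sigma> \<in> carrier_mat n n" "\<tau> \<in> carrier_mat m m"
    using \<sigma> \<tau> by (auto simp: flat_decomposable_def)
  have entry: "Re (kron_mat \<sigma> \<tau> $$ (i * m + j, i * m + j)) = Re (\<sigma> $$ (i, i)) * Re (\<tau> $$ (j, j))"
    if "i < n" "j < m" for i j
    using that c flat_decomposable_diagonal[OF \<sigma>(1) that(1)]
    by (simp add: kron_mat_def mult_add_less)
  obtain i j where ij: "i < n" "Re (\<sigma> $$ (i, i)) = K" "j < m" "Re (\<tau> $$ (j, j)) = L"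
    using \<sigma>(2) \<tau>(2) by (auto simp: max_diagonal_def)
  have "Re (kron_mat \<sigma> \<tau> $$ (l, l)) \<le> K * L" if l: "l < n * m" for l
  proof -
    have lm: "l div m < n" "l mod m < m" using l
      by (auto simp: less_mult_imp_div_less) (metis mod_less_divisor mult_0_right neq0_conv not_less0)
    have "Re (kron_mat \<sigma> \<tau> $$ (l, l)) = Re (\<sigma> $$ (l div m, l div m)) * Re (\<tau> $$ (l mod m, l mod m))"
      using entry[OF lm] by simp
    also have "\<dots> \<le> K * L"
      using \<sigma>(2) \<tau>(2) lm flat_decomposable_diagonal(2)[OF \<sigma>(1) lm(1)] flat_decomposable_diagonal(2)[OF \<tau>(1) lm(2)]
      unfolding max_diagonal_def by (meson mult_mono order_trans)
    finally show ?thesis .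
  qed
  moreover have "Re (kron_mat \<sigma> \<tau> $$ (i * m + j, i * m + j)) = K * L" using entry ij by simp
  ultimately show ?thesis
    unfolding max_diagonal_def using mult_add_less[OF ij(1,3)] by blast
qed

lemma flat_decomposable_tensor_pow:
  assumes "flat_decomposable d \<rho>" "max_diagonal d \<rho> L"
  shows "flat_decomposable (d ^ n) (tensor_pow \<rho> n) \<and> max_diagonal (d ^ n) (tensor_pow \<rho> n) (L ^ n)"
proof (induction n)
  case 0
  \<comment> \<open>The empty tensor power is a state of dimension 1, so the result for dimensions
    up to 3 covers it.\<close>
  have "density_mat 1 (1\<^sub>m 1)"
    by (auto simp: density_mat_def psd_mat_def mat_trace_def scalar_prod_def less_eq_complex_def)
  then have "flat_decomposable 1 (1\<^sub>m 1)" by (intro flat_decomposable_density) auto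
  then show ?case by (simp add: max_diagonal_def)
next
  case (Suc n)
  then show ?case
    using assms flat_decomposable_kron max_diagonal_kron by simp
qed

text \<open>The dephased matrix is diagonal with nonnegative entries, and the supremum is attained
  at the basis vector of the largest one.\<close>

lemma mat_op_norm_dephase:
  assumes flat: "flat_decomposable n \<tau>" and max: "max_diagonal n \<tau> L"
  shows "mat_op_norm (dephase \<tau>) = L"
proof -
  have \<tau>: "\<tau> \<in> carrier_mat n n" using flat by (simp add: flat_decomposable_def)
  have entry: "(dephase \<tau> *\<^sub>v v) $ i = of_real (Re (\<tau> $$ (i, i))) * v $ i"
    if "v \<in> carrier_vec n" "i < n" for v i
  proof -
    have "(dephase \<tau> *\<^sub>v v) $ i = (\<Sum>j<n. (if i = j then \<tau> $$ (i, j) else 0) * v $ j)"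
      using that \<tau> by (simp add: dephase_def scalar_prod_def lessThan_atLeast0)
    also have "\<dots> = (\<Sum>j<n. if j = i then \<tau> $$ (i, i) * v $ i else 0)"
      by (intro sum.cong refl) auto
    also have "\<tau> $$ (i, i) = of_real (Re (\<tau> $$ (i, i)))"
      using flat_decomposable_diagonal[OF flat that(2)] by (simp add: complex_eq_iff)
    finally show ?thesis using that by simp
  qed
  have norm: "vec_l2 (dephase \<tau> *\<^sub>v v) = sqrt (\<Sum>i<n. (Re (\<tau> $$ (i, i)))\<^sup>2 * (cmod (v $ i))\<^sup>2)"
    if v: "v \<in> carrier_vec n" for v
  proof -
    have "dephase \<tau> *\<^sub>v v \<in> carrier_vec n"
      using \<tau> v by (intro mult_mat_vec_carrier[of _ n n]) (auto simp: dephase_def)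
    then show ?thesis
      using entry[OF v] by (simp add: vec_l2_def Re_self_cscalar_prod norm_mult power_mult_distrib)
  qed
  obtain j where j: "j < n" "Re (\<tau> $$ (j, j)) = L" using max by (auto simp: max_diagonal_def)
  have L: "0 \<le> L" using flat_decomposable_diagonal[OF flat j(1)] j(2) by simp
  have dc: "dim_col (dephase \<tau>) = n" using \<tau> by (simp add: dephase_def)
  show ?thesis
    unfolding mat_op_norm_def dc
  proof (rule cSup_eq_maximum)
    let ?e = "unit_vec n j :: complex vec"
    have e: "?e \<in> carrier_vec n" by simp
    have "(\<Sum>i<n. (cmod (?e $ i))\<^sup>2) = (\<Sum>i<n. if i = j then 1 else 0)"
      using j by (intro sum.cong refl) auto
    then have "?e \<in> unit_vecs n" using j by (simp add: unit_vecs_iff)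
    moreover have "(\<Sum>i<n. (Re (\<tau> $$ (i, i)))\<^sup>2 * (cmod (?e $ i))\<^sup>2) = (\<Sum>i<n. if i = j then L\<^sup>2 else 0)"
      using j by (intro sum.cong refl) auto
    then have "vec_l2 (dephase \<tau> *\<^sub>v ?e) = L"
      using j L by (simp add: norm[OF e])
    ultimately show "L \<in> (\<lambda>v. vec_l2 (dephase \<tau> *\<^sub>v v)) ` unit_vecs n"
      by force
  next
    fix x assume "x \<in> (\<lambda>v. vec_l2 (dephase \<tau> *\<^sub>v v)) ` unit_vecs n"
    then obtain v where v: "v \<in> carrier_vec n" "(\<Sum>i<n. (cmod (v $ i))\<^sup>2) = 1"
      and x: "x = vec_l2 (dephase \<tau> *\<^sub>v v)" by (auto simp: unit_vecs_iff)
    have "(\<Sum>i<n. (Re (\<tau> $$ (i, i)))\<^sup>2 * (cmod (v $ i))\<^sup>2) \<le> (\<Sum>i<n. L\<^sup>2 * (cmod (v $ i))\<^sup>2)"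
      using max flat_decomposable_diagonal(2)[OF flat]
      by (intro sum_mono mult_right_mono power_mono) (auto simp: max_diagonal_def)
    also have "\<dots> = L\<^sup>2" using v(2) by (simp flip: sum_distrib_left)
    finally show "x \<le> L"
      using L by (simp add: x norm[OF v(1)] real_le_lsqrt real_sqrt_le_iff)
  qed
qed

text \<open>As \<open>x ^ n \<ge> 1\<close>, rounding down loses at most a factor 2, that is, at
  most 1 in the logarithm, which the factor \<open>1 / n\<close> makes negligible.\<close>

lemma log_floor_power_limit:
  fixes x :: real
  assumes "1 \<le> x"
  shows "(\<lambda>n. 1 / real n * log 2 (real (nat \<lfloor>x ^ n\<rfloor>))) \<longlonglongrightarrow> log 2 x"
proof (rule tendsto_sandwich)
  have bounds: "x ^ n / 2 \<le> real (nat \<lfloor>x ^ n\<rfloor>)" "real (nat \<lfloor>x ^ n\<rfloor>) \<le> x ^ n" for n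
  proof -
    have "1 \<le> x ^ n" using assms by simp
    then have floor: "real (nat \<lfloor>x ^ n\<rfloor>) = of_int \<lfloor>x ^ n\<rfloor>" "1 \<le> \<lfloor>x ^ n\<rfloor>" by simp_all
    then show "x ^ n / 2 \<le> real (nat \<lfloor>x ^ n\<rfloor>)" by linarith
    show "real (nat \<lfloor>x ^ n\<rfloor>) \<le> x ^ n" using floor(1) by simp
  qed
  show "\<forall>\<^sub>F n in sequentially. log 2 x - 1 / real n \<le> 1 / real n * log 2 (real (nat \<lfloor>x ^ n\<rfloor>))"
    using eventually_gt_at_top[of 0]
  proof eventually_elim
    case (elim n)
    have "real n * log 2 x - 1 = log 2 (x ^ n / 2)"
      using assms by (simp add: log_divide log_nat_power)
    also have "\<dots> \<le> log 2 (real (nat \<lfloor>x ^ n\<rfloor>))"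
      using assms bounds(1)[of n] by (intro log_mono) auto
    finally have "(real n * log 2 x - 1) / real n \<le> log 2 (real (nat \<lfloor>x ^ n\<rfloor>)) / real n"
      by (intro divide_right_mono) auto
    then show ?case using elim by (simp add: diff_divide_distrib)
  qed
  show "\<forall>\<^sub>F n in sequentially. 1 / real n * log 2 (real (nat \<lfloor>x ^ n\<rfloor>)) \<le> log 2 x"
    using eventually_gt_at_top[of 0]
  proof eventually_elim
    case (elim n)
    have "0 < x ^ n / 2" using assms by simp
    then have "0 < real (nat \<lfloor>x ^ n\<rfloor>)" using bounds(1)[of n] by linarith
    then have "log 2 (real (nat \<lfloor>x ^ n\<rfloor>)) \<le> log 2 (x ^ n)"
      using bounds(2)[of n] by (intro log_mono) auto
    also have "\<dots> = real n * log 2 x" using assms by (simp add: log_nat_power)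
    finally show ?case using elim by (simp add: field_simps)
  qed
  show "(\<lambda>n. log 2 x - 1 / real n) \<longlonglongrightarrow> log 2 x"
    using tendsto_diff[OF tendsto_const lim_inverse_n', of "log 2 x"] by simp
qed simp

theorem mainTheorem3:
  fixes d :: nat and \<rho> :: "complex mat" and \<O> :: operation_class
  assumes "\<O> \<in> {MIO, DIO, IO, SIO}"
    and "d \<in> {2, 3}"
    and "density_mat d \<rho>"
  shows "(\<lambda>n. 1 / real n * zero_error_assisted_rate \<O> (tensor_pow \<rho> n))
           \<longlonglongrightarrow> - log 2 (mat_op_norm (dephase \<rho>))"
proof -
  have flat: "flat_decomposable d \<rho>"
    using assms(2,3) by (intro flat_decomposable_density) auto
  define D where "D = (\<lambda>j. Re (\<rho> $$ (j, j))) ` {..<d}"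
  define L where "L = Max D"
  have D: "finite D" "D \<noteq> {}" using assms(2) by (auto simp: D_def lessThan_empty_iff)
  have max: "max_diagonal d \<rho> L"
    using Max_in[OF D] Max_ge[OF D(1)] by (auto simp: max_diagonal_def L_def D_def)
  \<comment> \<open>Unit trace places \<open>L\<close> between 0 (excluded) and 1: the sum is at
    most \<open>d * L\<close>, and no single nonnegative entry exceeds it.\<close>
  have "(\<Sum>j<d. Re (\<rho> $$ (j, j))) = 1"
    using assms(3) by (auto simp: density_mat_def psd_mat_def mat_trace_eq simp flip: Re_sum)
  moreover have "(\<Sum>j<d. Re (\<rho> $$ (j, j))) \<le> (\<Sum>j<d. L)"
    using max by (intro sum_mono) (auto simp: max_diagonal_def)
  ultimately have "0 < real d * L" by simp
  then have L0: "0 < L" by (simp add: zero_less_mult_iff)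
  obtain j where j: "j < d" "L = Re (\<rho> $$ (j, j))" using max by (auto simp: max_diagonal_def)
  have "Re (\<rho> $$ (j, j)) \<le> (\<Sum>j<d. Re (\<rho> $$ (j, j)))"
    using j flat_decomposable_diagonal(2)[OF flat] by (intro member_le_sum) auto
  then have L1: "L \<le> 1" using \<open>(\<Sum>j<d. Re (\<rho> $$ (j, j))) = 1\<close> j by simp
  have "zero_error_assisted_rate \<O> (tensor_pow \<rho> n) = log 2 (real (nat \<lfloor>(1 / L) ^ n\<rfloor>))" for n
    using zero_error_assisted_rate_flat[OF assms(1), of "d ^ n" "tensor_pow \<rho> n" "L ^ n"]
      flat_decomposable_tensor_pow[OF flat max, of n] L0 L1
    by (simp add: power_le_one power_one_over)
  moreover have "log 2 (1 / L) = - log 2 (mat_op_norm (dephase \<rho>))"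
    using L0 by (simp add: mat_op_norm_dephase[OF flat max] log_divide)
  ultimately show ?thesis
    using log_floor_power_limit[of "1 / L"] L0 L1 by simp
qed

end
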